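(* Let $\mathscr{C}$ be an extriangulated category and $\mathcal{X}$ a semibrick in $\mathscr{C}$. Assume that the extriangulated category $\mathcal{T}=\mathbf{Filt}_{\mathscr{C}}(\mathcal{X})$ has enough projectives and enough injectives, and let $\mathcal{P}$ be the full subcategory of projective objects of $\mathcal{T}$. The assignments $\mathcal{U}\mapsto\mathcal{S}_{\mathcal{U}}$ and $\mathcal{S}\mapsto\mathbf{Filt}_{\mathcal{T}}(\mathcal{S})$ give a one-to-one correspondence between the following two sets: (1) the set of filtration subcategories $\mathcal{U}$ in $\mathcal{T}$ such that $(\mathcal{U},\mathcal{U}^{\perp_1})$ is a cotorsion pair in $\mathcal{T}$; (2) the set of subsets $\mathcal{S}$ of $\mathcal{X}$ such that $\mathcal{S}_{\mathcal{P}}\subseteq\mathcal{S}$.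
   Context: Conventions: all categories are skeletally small, Hom-finite, Krull–Schmidt and $k$-linear over a fixed field $k$; subcategories are full and closed under isomorphisms; a set of (isoclasses of) objects is identified with the corresponding full subcategory. Extriangulated categories (Nakaoka–Palu). Let $\mathscr{C}$ be an additive category and $\mathbb{E}:\mathscr{C}^{op}\times\mathscr{C}\to Ab$ a biadditive functor; elements $\delta\in\mathbb{E}(C,A)$ are $\mathbb{E}$-extensions, and $a_*\delta=\mathbb{E}(C,a)(\delta)$, $c^*\delta=\mathbb{E}(c,A)(\delta)$. A morphism from $\delta\in\mathbb{E}(C,A)$ to $\delta'\in\mathbb{E}(C',A')$ is a pair $(a,c)$, $a:A\to A'$, $c:C\to C'$, with $a_*\delta=c^*\delta'$. Sequences $A\to B\to C$ and $A\to B'\to C$ are equivalent if there is an isomorphism $B\to B'$ compatible with the identities of $A$ and $C$. A realization $\mathfrak{s}$ assigns to each $\delta\in\mathbb{E}(C,A)$ an equivalence class $\mathfrak{s}(\delta)=[A\to B\to C]$ such that for each morphism $(a,c):\delta\to\delta'$ there is $b:B\to B'$ making $(a,b,c)$ a commutative diagram between representatives (then $(a,b,c)$ realizes $(a,c)$); it is additive if $\mathfrak{s}(0)=[A\to A\oplus C\to C]$ (split sequence) and $\mathfrak{s}(\delta\oplus\delta')=\mathfrak{s}(\delta)\oplus\mathfrak{s}(\delta')$. $(\mathscr{C},\mathbb{E},\mathfrak{s})$ is extriangulated if $\mathfrak{s}$ is an additive realization and: (ET3) for $\mathfrak{s}(\delta)=[A\xrightarrow{x}B\xrightarrow{y}C]$,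 $\mathfrak{s}(\delta')=[A'\xrightarrow{x'}B'\xrightarrow{y'}C']$ and $a,b$ with $bx=x'a$, there is $c$ such that $(a,c):\delta\to\delta'$ is a morphism realized by $(a,b,c)$; (ET3)$^{op}$ the dual; (ET4) for $\delta\in\mathbb{E}(D,A)$, $\delta'\in\mathbb{E}(F,B)$ realized by $A\xrightarrow{f}B\xrightarrow{f'}D$ and $B\xrightarrow{g}C\xrightarrow{g'}F$ there are an object $E$, morphisms $h=gf:A\to C$, $h':C\to E$, $d:D\to E$, $e:E\to F$ with $h'g=df'$, $eh'=g'$, and $\delta''\in\mathbb{E}(E,A)$ realized by $A\xrightarrow{h}C\xrightarrow{h'}E$ such that $D\xrightarrow{d}E\xrightarrow{e}F$ realizes $f'_*\delta'$, $d^*\delta''=\delta$ and $f_*\delta''=e^*\delta'$; (ET4)$^{op}$ the dual. If $\mathfrak{s}(\delta)=[A\xrightarrow{x}B\xrightarrow{y}C]$, then $A\xrightarrow{x}B\xrightarrow{y}C$ is a conflation, $x$ an inflation, $y$ a deflation, $A\to B\to C\stackrel{\delta}{\dashrightarrow}$ an $\mathbb{E}$-triangle, $C=\mathrm{cone}(x)$ and $A=\mathrm{cocone}(y)$. An extension-closed subcategory (one containing the middle term of every $\mathbb{E}$-triangle whose end terms it contains) is itself extriangulated with the restricted structure. Filtration subcategory: for a collection $\mathcal{X}$ of objects of an extriangulated category $\mathscr{C}$, $\mathbf{Filt}_{\mathscr{C}}(\mathcal{X})$ consists of all objects $M$ admitting a finite filtration $0=X_0\xrightarrow{f_0}X_1\xrightarrow{f_1}\cdots\xrightarrow{f_{n-1}}X_n=M$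 with each $f_i$ an inflation and $\mathrm{cone}(f_i)\in\mathcal{X}$. It is extension-closed, hence extriangulated. Semibricks: a brick is an object whose endomorphism ring is a division algebra; a semibrick is a set $\mathcal{X}$ of isoclasses of bricks with $\mathrm{Hom}(X_1,X_2)=0$ for any two non-isomorphic $X_1,X_2\in\mathcal{X}$. With $\mathcal{T}=\mathbf{Filt}_{\mathscr{C}}(\mathcal{X})$, a filtration subcategory of $\mathcal{T}$ is a subcategory of the form $\mathbf{Filt}_{\mathcal{T}}(\mathcal{Y})$ for some subset $\mathcal{Y}\subseteq\mathcal{X}$. For a subcategory $\mathcal{D}$ of $\mathcal{T}$, $\mathcal{S}_{\mathcal{D}}$ denotes the subset of $\mathcal{X}$ such that $\mathbf{Filt}_{\mathcal{T}}(\mathcal{S}_{\mathcal{D}})$ is the smallest filtration subcategory of $\mathcal{T}$ containing $\mathcal{D}$. Projectives: an object $P$ of an extriangulated category is projective if for every conflation $A\xrightarrow{x}B\xrightarrow{y}C$ every morphism $P\to C$ factors through $y$; injective objects are defined dually. The category has enough projectives if for every object $M$ there is an $\mathbb{E}$-triangle $A\to P\to M\dashrightarrow$ with $P$ projective; enough injectives is dual. For a subcategory $\mathcal{U}$ of $\mathcal{T}$, $\mathcal{U}^{\perp_1}=\{M\in\mathcal{T}\mid\mathbb{E}(\mathcal{U},M)=0\}$. A pair $(\mathcal{U},\mathcal{V})$ of subcategories of an extriangulated category $\mathcal{T}$, closed under direct summands, is a cotorsion pair in $\mathcal{T}$ if $\mathbb{E}(\mathcal{U},\mathcal{V})=0$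 and for any $C\in\mathcal{T}$ there are conflations $V\to U\to C$ and $C\to V'\to U'$ with $U,U'\in\mathcal{U}$ and $V,V'\in\mathcal{V}$. *)

theory Defs
  imports "HOL-Algebra.Module" "HOL-Algebra.AbelCoset"
begin

section \<open>Linear categories\<close>

text \<open>
  Hom-spaces are modules over a ring K in the sense of HOL-Algebra (only the additive group and
  the scalar multiplication are used). The sets Hom(A,B) are pairwise disjoint, so the
  composition need not be indexed by objects.
\<close>

record ('o, 'm, 'k) lin_cat =
  objs :: "'o set"
  Hom :: "'o \<Rightarrow> 'o \<Rightarrow> ('k, 'm) module"
  cmp :: "'m \<Rightarrow> 'm \<Rightarrow> 'm" (infixr "\<cdot>\<index>" 70)
  ident :: "'o \<Rightarrow> 'm"

abbreviation arr :: "('o, 'm, 'k, 'z) lin_cat_scheme \<Rightarrow> 'o \<Rightarrow> 'o \<Rightarrow> 'm set" where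
  "arr C A B \<equiv> carrier (Hom C A B)"

locale linear_category = field K
  for K :: "('k, 'r) ring_scheme" (structure) and C :: "('o, 'm, 'k, 'z) lin_cat_scheme" +
  assumes hom_module: "\<lbrakk>A \<in> objs C; B \<in> objs C\<rbrakk> \<Longrightarrow> module K (Hom C A B)"
    and hom_disjoint: "\<lbrakk>A \<in> objs C; B \<in> objs C; A' \<in> objs C; B' \<in> objs C;
      f \<in> arr C A B; f \<in> arr C A' B'\<rbrakk> \<Longrightarrow> A = A' \<and> B = B'"
    and cmp_closed: "\<lbrakk>A \<in> objs C; B \<in> objs C; D \<in> objs C; f \<in> arr C A B; g \<in> arr C B D\<rbrakk>
      \<Longrightarrow> g \<cdot>\<^bsub>C\<^esub> f \<in> arr C A D"
    and cmp_assoc: "\<lbrakk>A \<in> objs C; B \<in> objs C; D \<in> objs C; E \<in> objs C;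
      f \<in> arr C A B; g \<in> arr C B D; h \<in> arr C D E\<rbrakk>
      \<Longrightarrow> h \<cdot>\<^bsub>C\<^esub> (g \<cdot>\<^bsub>C\<^esub> f) = (h \<cdot>\<^bsub>C\<^esub> g) \<cdot>\<^bsub>C\<^esub> f"
    and ident_closed: "A \<in> objs C \<Longrightarrow> ident C A \<in> arr C A A"
    and ident_right: "\<lbrakk>A \<in> objs C; B \<in> objs C; f \<in> arr C A B\<rbrakk> \<Longrightarrow> f \<cdot>\<^bsub>C\<^esub> ident C A = f"
    and ident_left: "\<lbrakk>A \<in> objs C; B \<in> objs C; f \<in> arr C A B\<rbrakk> \<Longrightarrow> ident C B \<cdot>\<^bsub>C\<^esub> f = f"
    and cmp_add_right: "\<lbrakk>A \<in> objs C; B \<in> objs C; D \<in> objs C;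
      f \<in> arr C A B; f' \<in> arr C A B; g \<in> arr C B D\<rbrakk>
      \<Longrightarrow> g \<cdot>\<^bsub>C\<^esub> (f \<oplus>\<^bsub>Hom C A B\<^esub> f') = (g \<cdot>\<^bsub>C\<^esub> f) \<oplus>\<^bsub>Hom C A D\<^esub> (g \<cdot>\<^bsub>C\<^esub> f')"
    and cmp_add_left: "\<lbrakk>A \<in> objs C; B \<in> objs C; D \<in> objs C;
      f \<in> arr C A B; g \<in> arr C B D; g' \<in> arr C B D\<rbrakk>
      \<Longrightarrow> (g \<oplus>\<^bsub>Hom C B D\<^esub> g') \<cdot>\<^bsub>C\<^esub> f = (g \<cdot>\<^bsub>C\<^esub> f) \<oplus>\<^bsub>Hom C A D\<^esub> (g' \<cdot>\<^bsub>C\<^esub> f)"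
    and cmp_smult_right: "\<lbrakk>A \<in> objs C; B \<in> objs C; D \<in> objs C;
      f \<in> arr C A B; g \<in> arr C B D; r \<in> carrier K\<rbrakk>
      \<Longrightarrow> g \<cdot>\<^bsub>C\<^esub> (r \<odot>\<^bsub>Hom C A B\<^esub> f) = r \<odot>\<^bsub>Hom C A D\<^esub> (g \<cdot>\<^bsub>C\<^esub> f)"
    and cmp_smult_left: "\<lbrakk>A \<in> objs C; B \<in> objs C; D \<in> objs C;
      f \<in> arr C A B; g \<in> arr C B D; r \<in> carrier K\<rbrakk>
      \<Longrightarrow> (r \<odot>\<^bsub>Hom C B D\<^esub> g) \<cdot>\<^bsub>C\<^esub> f = r \<odot>\<^bsub>Hom C A D\<^esub> (g \<cdot>\<^bsub>C\<^esub> f)"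

definition isomorphism :: "('o, 'm, 'k, 'z) lin_cat_scheme \<Rightarrow> 'o \<Rightarrow> 'o \<Rightarrow> 'm \<Rightarrow> bool" where
  "isomorphism C A B f \<longleftrightarrow> f \<in> arr C A B \<and>
     (\<exists>g\<in>arr C B A. g \<cdot>\<^bsub>C\<^esub> f = ident C A \<and> f \<cdot>\<^bsub>C\<^esub> g = ident C B)"

definition isomorphic :: "('o, 'm, 'k, 'z) lin_cat_scheme \<Rightarrow> 'o \<Rightarrow> 'o \<Rightarrow> bool" where
  "isomorphic C A B \<longleftrightarrow> (\<exists>f. isomorphism C A B f)"

text \<open>
  Subcategories are full and closed under isomorphisms, hence given by their objects. A set of
  isoclasses of objects is identified with the corresponding subcategory, i.e. with the union of
  these isoclasses.
\<close>

definition subcategory :: "('o, 'm, 'k, 'z) lin_cat_scheme \<Rightarrow> 'o set \<Rightarrow> bool" where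
  "subcategory C D \<longleftrightarrow> D \<subseteq> objs C \<and> (\<forall>A\<in>D. \<forall>B\<in>objs C. isomorphic C A B \<longrightarrow> B \<in> D)"

definition zero_object :: "('o, 'm, 'k, 'z) lin_cat_scheme \<Rightarrow> 'o \<Rightarrow> bool" where
  "zero_object C Z \<longleftrightarrow> Z \<in> objs C \<and>
     (\<forall>A\<in>objs C. arr C Z A = {\<zero>\<^bsub>Hom C Z A\<^esub>} \<and> arr C A Z = {\<zero>\<^bsub>Hom C A Z\<^esub>})"

definition biproduct ::
  "('o, 'm, 'k, 'z) lin_cat_scheme \<Rightarrow> 'o \<Rightarrow> 'o \<Rightarrow> 'o \<Rightarrow> 'm \<Rightarrow> 'm \<Rightarrow> 'm \<Rightarrow> 'm \<Rightarrow> bool" where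
  "biproduct C A A' S i i' p p' \<longleftrightarrow>
     A \<in> objs C \<and> A' \<in> objs C \<and> S \<in> objs C \<and>
     i \<in> arr C A S \<and> i' \<in> arr C A' S \<and> p \<in> arr C S A \<and> p' \<in> arr C S A' \<and>
     p \<cdot>\<^bsub>C\<^esub> i = ident C A \<and> p' \<cdot>\<^bsub>C\<^esub> i' = ident C A' \<and>
     p \<cdot>\<^bsub>C\<^esub> i' = \<zero>\<^bsub>Hom C A' A\<^esub> \<and> p' \<cdot>\<^bsub>C\<^esub> i = \<zero>\<^bsub>Hom C A A'\<^esub> \<and>
     (i \<cdot>\<^bsub>C\<^esub> p) \<oplus>\<^bsub>Hom C S S\<^esub> (i' \<cdot>\<^bsub>C\<^esub> p') = ident C S"

locale additive_linear_category = linear_category +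
  assumes ex_zero_object: "\<exists>Z. zero_object C Z"
    and ex_biproduct: "\<lbrakk>A \<in> objs C; A' \<in> objs C\<rbrakk> \<Longrightarrow> \<exists>S i i' p p'. biproduct C A A' S i i' p p'"

definition closed_under_summands :: "('o, 'm, 'k, 'z) lin_cat_scheme \<Rightarrow> 'o set \<Rightarrow> bool" where
  "closed_under_summands C D \<longleftrightarrow>
     (\<forall>A A' S i i' p p'. biproduct C A A' S i i' p p' \<and> S \<in> D \<longrightarrow> A \<in> D \<and> A' \<in> D)"

definition End_ring :: "('o, 'm, 'k, 'z) lin_cat_scheme \<Rightarrow> 'o \<Rightarrow> 'm ring" where
  "End_ring C A = \<lparr>carrier = arr C A A, mult = cmp C, one = ident C A,
     zero = \<zero>\<^bsub>Hom C A A\<^esub>, add = add (Hom C A A)\<rparr>"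

definition division_ring :: "('a, 'b) ring_scheme \<Rightarrow> bool" where
  "division_ring R \<longleftrightarrow> ring R \<and> \<one>\<^bsub>R\<^esub> \<noteq> \<zero>\<^bsub>R\<^esub> \<and> Units R = carrier R - {\<zero>\<^bsub>R\<^esub>}"

definition local_ring :: "('a, 'b) ring_scheme \<Rightarrow> bool" where
  "local_ring R \<longleftrightarrow> ring R \<and> \<one>\<^bsub>R\<^esub> \<noteq> \<zero>\<^bsub>R\<^esub> \<and>
     (\<forall>a \<in> carrier R - Units R. \<forall>b \<in> carrier R - Units R. a \<oplus>\<^bsub>R\<^esub> b \<notin> Units R)"

definition hom_finite :: "('k, 'r) ring_scheme \<Rightarrow> ('o, 'm, 'k, 'z) lin_cat_scheme \<Rightarrow> bool" where
  "hom_finite K C \<longleftrightarrow> (\<forall>A\<in>objs C. \<forall>B\<in>objs C. \<exists>G. finite G \<and> G \<subseteq> arr C A B \<and>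
     (\<forall>f\<in>arr C A B. \<exists>c\<in>G \<rightarrow> carrier K.
        f = (\<Oplus>\<^bsub>Hom C A B\<^esub>g\<in>G. c g \<odot>\<^bsub>Hom C A B\<^esub> g)))"

text \<open>Every object is a finite direct sum of objects with local endomorphism rings.\<close>

definition krull_schmidt :: "('o, 'm, 'k, 'z) lin_cat_scheme \<Rightarrow> bool" where
  "krull_schmidt C \<longleftrightarrow> (\<forall>M\<in>objs C. \<exists>(n::nat) N i p.
     (\<forall>j<n. N j \<in> objs C \<and> local_ring (End_ring C (N j)) \<and>
        i j \<in> arr C (N j) M \<and> p j \<in> arr C M (N j)) \<and>
     (\<forall>j<n. \<forall>l<n. p j \<cdot>\<^bsub>C\<^esub> i l = (if j = l then ident C (N j) else \<zero>\<^bsub>Hom C (N l) (N j)\<^esub>)) \<and>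
     (\<Oplus>\<^bsub>Hom C M M\<^esub>j\<in>{..<n}. i j \<cdot>\<^bsub>C\<^esub> p j) = ident C M)"


section \<open>Extriangulated categories\<close>

text \<open>
  The bifunctor: \<open>EE C Z A\<close> is the group E(Z,A) (contravariant in Z; only the additive part of
  the ring record is used), \<open>push C Z a\<close> is E(Z,a) and \<open>pull C c A\<close> is E(c,A).
  The realization: \<open>rlz C Z A d\<close> is the equivalence class s(d), as the set of all pairs (x,y) such
  that A -x-> B -y-> Z represents it; B is determined by x.
\<close>

record ('o, 'm, 'k, 'e) extri_cat = "('o, 'm, 'k) lin_cat" +
  EE :: "'o \<Rightarrow> 'o \<Rightarrow> 'e ring"
  push :: "'o \<Rightarrow> 'm \<Rightarrow> 'e \<Rightarrow> 'e"
  pull :: "'m \<Rightarrow> 'o \<Rightarrow> 'e \<Rightarrow> 'e"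
  rlz :: "'o \<Rightarrow> 'o \<Rightarrow> 'e \<Rightarrow> ('m \<times> 'm) set"

abbreviation exts :: "('o, 'm, 'k, 'e, 'z) extri_cat_scheme \<Rightarrow> 'o \<Rightarrow> 'o \<Rightarrow> 'e set" where
  "exts C Z A \<equiv> carrier (EE C Z A)"

definition seq_equiv ::
  "('o, 'm, 'k, 'z) lin_cat_scheme \<Rightarrow> 'o \<Rightarrow> 'o \<Rightarrow> 'm \<times> 'm \<Rightarrow> 'm \<times> 'm \<Rightarrow> bool" where
  "seq_equiv C A Z = (\<lambda>(x, y) (x', y').
     \<exists>B\<in>objs C. \<exists>B'\<in>objs C. \<exists>b. x \<in> arr C A B \<and> y \<in> arr C B Z \<and>
       x' \<in> arr C A B' \<and> y' \<in> arr C B' Z \<and>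
       isomorphism C B B' b \<and> b \<cdot>\<^bsub>C\<^esub> x = x' \<and> y' \<cdot>\<^bsub>C\<^esub> b = y)"

text \<open>The E-triangle A -x-> B -y-> Z with extension d, i.e. s(d) = [A -x-> B -y-> Z].\<close>

definition etriangle ::
  "('o, 'm, 'k, 'e, 'z) extri_cat_scheme \<Rightarrow> 'o \<Rightarrow> 'm \<Rightarrow> 'o \<Rightarrow> 'm \<Rightarrow> 'o \<Rightarrow> 'e \<Rightarrow> bool" where
  "etriangle C A x B y Z d \<longleftrightarrow> A \<in> objs C \<and> B \<in> objs C \<and> Z \<in> objs C \<and>
     x \<in> arr C A B \<and> y \<in> arr C B Z \<and> d \<in> exts C Z A \<and> (x, y) \<in> rlz C Z A d"

definition conflation ::
  "('o, 'm, 'k, 'e, 'z) extri_cat_scheme \<Rightarrow> 'o \<Rightarrow> 'm \<Rightarrow> 'o \<Rightarrow> 'm \<Rightarrow> 'o \<Rightarrow> bool" where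
  "conflation C A x B y Z \<longleftrightarrow> (\<exists>d. etriangle C A x B y Z d)"

definition biadditive_functor :: "('o, 'm, 'k, 'e, 'z) extri_cat_scheme \<Rightarrow> bool" where
  "biadditive_functor C \<longleftrightarrow>
     (\<forall>A\<in>objs C. \<forall>Z\<in>objs C. abelian_group (EE C Z A)) \<and>
     (\<forall>A\<in>objs C. \<forall>A'\<in>objs C. \<forall>Z\<in>objs C. \<forall>a\<in>arr C A A'.
        abelian_group_hom (EE C Z A) (EE C Z A') (push C Z a)) \<and>
     (\<forall>A\<in>objs C. \<forall>Z\<in>objs C. \<forall>Z'\<in>objs C. \<forall>c\<in>arr C Z' Z.
        abelian_group_hom (EE C Z A) (EE C Z' A) (pull C c A)) \<and>
     (\<forall>A\<in>objs C. \<forall>Z\<in>objs C. \<forall>d\<in>exts C Z A.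
        push C Z (ident C A) d = d \<and> pull C (ident C Z) A d = d) \<and>
     (\<forall>A\<in>objs C. \<forall>A'\<in>objs C. \<forall>A''\<in>objs C. \<forall>Z\<in>objs C.
        \<forall>a\<in>arr C A A'. \<forall>a'\<in>arr C A' A''. \<forall>d\<in>exts C Z A.
        push C Z (a' \<cdot>\<^bsub>C\<^esub> a) d = push C Z a' (push C Z a d)) \<and>
     (\<forall>A\<in>objs C. \<forall>Z\<in>objs C. \<forall>Z'\<in>objs C. \<forall>Z''\<in>objs C.
        \<forall>c\<in>arr C Z' Z. \<forall>c'\<in>arr C Z'' Z'. \<forall>d\<in>exts C Z A.
        pull C (c \<cdot>\<^bsub>C\<^esub> c') A d = pull C c' A (pull C c A d)) \<and>
     (\<forall>A\<in>objs C. \<forall>A'\<in>objs C. \<forall>Z\<in>objs C. \<forall>Z'\<in>objs C.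
        \<forall>a\<in>arr C A A'. \<forall>c\<in>arr C Z' Z. \<forall>d\<in>exts C Z A.
        push C Z' a (pull C c A d) = pull C c A' (push C Z a d)) \<and>
     (\<forall>A\<in>objs C. \<forall>A'\<in>objs C. \<forall>Z\<in>objs C. \<forall>a\<in>arr C A A'. \<forall>b\<in>arr C A A'. \<forall>d\<in>exts C Z A.
        push C Z (a \<oplus>\<^bsub>Hom C A A'\<^esub> b) d = push C Z a d \<oplus>\<^bsub>EE C Z A'\<^esub> push C Z b d) \<and>
     (\<forall>A\<in>objs C. \<forall>Z\<in>objs C. \<forall>Z'\<in>objs C. \<forall>c\<in>arr C Z' Z. \<forall>b\<in>arr C Z' Z. \<forall>d\<in>exts C Z A.
        pull C (c \<oplus>\<^bsub>Hom C Z' Z\<^esub> b) A d = pull C c A d \<oplus>\<^bsub>EE C Z' A\<^esub> pull C b A d)"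

definition realization :: "('o, 'm, 'k, 'e, 'z) extri_cat_scheme \<Rightarrow> bool" where
  "realization C \<longleftrightarrow>
     (\<forall>A\<in>objs C. \<forall>Z\<in>objs C. \<forall>d\<in>exts C Z A. \<exists>B\<in>objs C. \<exists>x\<in>arr C A B. \<exists>y\<in>arr C B Z.
        rlz C Z A d = {s. seq_equiv C A Z (x, y) s}) \<and>
     (\<forall>A x B y Z d A' x' B' y' Z' d' a c.
        etriangle C A x B y Z d \<and> etriangle C A' x' B' y' Z' d' \<and>
        a \<in> arr C A A' \<and> c \<in> arr C Z Z' \<and> push C Z a d = pull C c A' d' \<longrightarrow>
        (\<exists>b\<in>arr C B B'. b \<cdot>\<^bsub>C\<^esub> x = x' \<cdot>\<^bsub>C\<^esub> a \<and> y' \<cdot>\<^bsub>C\<^esub> b = c \<cdot>\<^bsub>C\<^esub> y))"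

text \<open>
  In the second clause, AA, BB, ZZ are arbitrary biproducts of A and A', B and B', Z and Z', with
  injections i, i', j, j', k, k' and projections p, p', q, q', r, r'. The direct sum of extensions
  is the element of E(ZZ,AA) corresponding to (d,0,0,d') under additivity of E.
\<close>

definition additive_realization :: "('o, 'm, 'k, 'e, 'z) extri_cat_scheme \<Rightarrow> bool" where
  "additive_realization C \<longleftrightarrow> realization C \<and>
     (\<forall>A Z B i i' p p'. biproduct C A Z B i i' p p' \<longrightarrow>
        etriangle C A i B p' Z \<zero>\<^bsub>EE C Z A\<^esub>) \<and>
     (\<forall>A x B y Z d A' x' B' y' Z' d' AA i i' p p' BB j j' q q' ZZ k k' r r'.
        etriangle C A x B y Z d \<and> etriangle C A' x' B' y' Z' d' \<and>
        biproduct C A A' AA i i' p p' \<and> biproduct C B B' BB j j' q q' \<and>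
        biproduct C Z Z' ZZ k k' r r' \<longrightarrow>
        etriangle C
          AA ((j \<cdot>\<^bsub>C\<^esub> x \<cdot>\<^bsub>C\<^esub> p) \<oplus>\<^bsub>Hom C AA BB\<^esub> (j' \<cdot>\<^bsub>C\<^esub> x' \<cdot>\<^bsub>C\<^esub> p'))
          BB ((k \<cdot>\<^bsub>C\<^esub> y \<cdot>\<^bsub>C\<^esub> q) \<oplus>\<^bsub>Hom C BB ZZ\<^esub> (k' \<cdot>\<^bsub>C\<^esub> y' \<cdot>\<^bsub>C\<^esub> q'))
          ZZ (push C ZZ i (pull C r A d) \<oplus>\<^bsub>EE C ZZ AA\<^esub> push C ZZ i' (pull C r' A' d')))"

definition ET3 :: "('o, 'm, 'k, 'e, 'z) extri_cat_scheme \<Rightarrow> bool" where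
  "ET3 C \<longleftrightarrow> (\<forall>A x B y Z d A' x' B' y' Z' d' a b.
     etriangle C A x B y Z d \<and> etriangle C A' x' B' y' Z' d' \<and>
     a \<in> arr C A A' \<and> b \<in> arr C B B' \<and> b \<cdot>\<^bsub>C\<^esub> x = x' \<cdot>\<^bsub>C\<^esub> a \<longrightarrow>
     (\<exists>c\<in>arr C Z Z'. y' \<cdot>\<^bsub>C\<^esub> b = c \<cdot>\<^bsub>C\<^esub> y \<and> push C Z a d = pull C c A' d'))"

definition ET3_op :: "('o, 'm, 'k, 'e, 'z) extri_cat_scheme \<Rightarrow> bool" where
  "ET3_op C \<longleftrightarrow> (\<forall>A x B y Z d A' x' B' y' Z' d' b c.
     etriangle C A x B y Z d \<and> etriangle C A' x' B' y' Z' d' \<and>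
     b \<in> arr C B B' \<and> c \<in> arr C Z Z' \<and> y' \<cdot>\<^bsub>C\<^esub> b = c \<cdot>\<^bsub>C\<^esub> y \<longrightarrow>
     (\<exists>a\<in>arr C A A'. b \<cdot>\<^bsub>C\<^esub> x = x' \<cdot>\<^bsub>C\<^esub> a \<and> push C Z a d = pull C c A' d'))"

text \<open>In the next two axioms, H, F, G play the roles of C, E, F in the usual notation.\<close>

definition ET4 :: "('o, 'm, 'k, 'e, 'z) extri_cat_scheme \<Rightarrow> bool" where
  "ET4 C \<longleftrightarrow> (\<forall>A f B f' D d1 g H g' G d2.
     etriangle C A f B f' D d1 \<and> etriangle C B g H g' G d2 \<longrightarrow>
     (\<exists>F\<in>objs C. \<exists>h'\<in>arr C H F. \<exists>d\<in>arr C D F. \<exists>e\<in>arr C F G. \<exists>d3\<in>exts C F A.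
        h' \<cdot>\<^bsub>C\<^esub> g = d \<cdot>\<^bsub>C\<^esub> f' \<and> e \<cdot>\<^bsub>C\<^esub> h' = g' \<and>
        etriangle C A (g \<cdot>\<^bsub>C\<^esub> f) H h' F d3 \<and>
        etriangle C D d F e G (push C G f' d2) \<and>
        pull C d A d3 = d1 \<and>
        push C F f d3 = pull C e B d2))"

definition ET4_op :: "('o, 'm, 'k, 'e, 'z) extri_cat_scheme \<Rightarrow> bool" where
  "ET4_op C \<longleftrightarrow> (\<forall>A f B f' D d1 g H g' G d2.
     etriangle C D f' B f A d1 \<and> etriangle C G g' H g B d2 \<longrightarrow>
     (\<exists>F\<in>objs C. \<exists>h'\<in>arr C F H. \<exists>d\<in>arr C F D. \<exists>e\<in>arr C G F. \<exists>d3\<in>exts C A F.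
        g \<cdot>\<^bsub>C\<^esub> h' = f' \<cdot>\<^bsub>C\<^esub> d \<and> h' \<cdot>\<^bsub>C\<^esub> e = g' \<and>
        etriangle C F h' H (f \<cdot>\<^bsub>C\<^esub> g) A d3 \<and>
        etriangle C G e F d D (pull C f' G d2) \<and>
        push C A d d3 = d1 \<and>
        pull C f F d3 = push C B e d2))"

locale extriangulated_category = additive_linear_category K C
  for K :: "('k, 'r) ring_scheme" (structure) and C :: "('o, 'm, 'k, 'e, 'z) extri_cat_scheme" +
  assumes biadditive_functor: "biadditive_functor C"
    and additive_realization: "additive_realization C"
    and ET3: "ET3 C"
    and ET3_op: "ET3_op C"
    and ET4: "ET4 C"
    and ET4_op: "ET4_op C"

text \<open>
  The restricted structure on a subcategory D. The realization needs no adjustment: if D is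
  extension-closed and closed under isomorphisms, then all sequences realizing an extension of
  objects of D already lie in D.
\<close>

definition restrict_to ::
  "('o, 'm, 'k, 'e) extri_cat \<Rightarrow> 'o set \<Rightarrow> ('o, 'm, 'k, 'e) extri_cat" where
  "restrict_to C D = C\<lparr>objs := D\<rparr>"

definition is_projective :: "('o, 'm, 'k, 'e, 'z) extri_cat_scheme \<Rightarrow> 'o \<Rightarrow> bool" where
  "is_projective C P \<longleftrightarrow> P \<in> objs C \<and>
     (\<forall>A x B y Z. conflation C A x B y Z \<longrightarrow>
        (\<forall>f\<in>arr C P Z. \<exists>g\<in>arr C P B. f = y \<cdot>\<^bsub>C\<^esub> g))"

definition is_injective :: "('o, 'm, 'k, 'e, 'z) extri_cat_scheme \<Rightarrow> 'o \<Rightarrow> bool" where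
  "is_injective C I \<longleftrightarrow> I \<in> objs C \<and>
     (\<forall>A x B y Z. conflation C A x B y Z \<longrightarrow>
        (\<forall>f\<in>arr C A I. \<exists>g\<in>arr C B I. f = g \<cdot>\<^bsub>C\<^esub> x))"

definition projectives :: "('o, 'm, 'k, 'e, 'z) extri_cat_scheme \<Rightarrow> 'o set" where
  "projectives C = {P. is_projective C P}"

definition enough_projectives :: "('o, 'm, 'k, 'e, 'z) extri_cat_scheme \<Rightarrow> bool" where
  "enough_projectives C \<longleftrightarrow>
     (\<forall>M\<in>objs C. \<exists>A x P y d. is_projective C P \<and> etriangle C A x P y M d)"

definition enough_injectives :: "('o, 'm, 'k, 'e, 'z) extri_cat_scheme \<Rightarrow> bool" where
  "enough_injectives C \<longleftrightarrow>
     (\<forall>M\<in>objs C. \<exists>x I y Z d. is_injective C I \<and> etriangle C M x I y Z d)"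

definition perp1 :: "('o, 'm, 'k, 'e, 'z) extri_cat_scheme \<Rightarrow> 'o set \<Rightarrow> 'o set" where
  "perp1 C \<U> = {M \<in> objs C. \<forall>U\<in>\<U>. exts C U M = {\<zero>\<^bsub>EE C U M\<^esub>}}"

definition cotorsion_pair :: "('o, 'm, 'k, 'e, 'z) extri_cat_scheme \<Rightarrow> 'o set \<Rightarrow> 'o set \<Rightarrow> bool" where
  "cotorsion_pair C \<U> \<V> \<longleftrightarrow>
     subcategory C \<U> \<and> subcategory C \<V> \<and>
     closed_under_summands C \<U> \<and> closed_under_summands C \<V> \<and>
     (\<forall>U\<in>\<U>. \<forall>V\<in>\<V>. exts C U V = {\<zero>\<^bsub>EE C U V\<^esub>}) \<and>
     (\<forall>M\<in>objs C. (\<exists>V\<in>\<V>. \<exists>U\<in>\<U>. \<exists>x y. conflation C V x U y M) \<and>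
                 (\<exists>V'\<in>\<V>. \<exists>U'\<in>\<U>. \<exists>x y. conflation C M x V' y U'))"


section \<open>Semibricks and filtration subcategories\<close>

definition Filt :: "('o, 'm, 'k, 'e, 'z) extri_cat_scheme \<Rightarrow> 'o set \<Rightarrow> 'o set" where
  "Filt C \<X> = {M. \<exists>(n::nat) X f. zero_object C (X 0) \<and> X n = M \<and>
     (\<forall>i<n. \<exists>Z\<in>\<X>. \<exists>y. conflation C (X i) (f i) (X (Suc i)) y Z)}"

definition brick :: "('o, 'm, 'k, 'z) lin_cat_scheme \<Rightarrow> 'o \<Rightarrow> bool" where
  "brick C X \<longleftrightarrow> X \<in> objs C \<and> division_ring (End_ring C X)"

definition semibrick :: "('o, 'm, 'k, 'z) lin_cat_scheme \<Rightarrow> 'o set \<Rightarrow> bool" where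
  "semibrick C \<X> \<longleftrightarrow> subcategory C \<X> \<and> (\<forall>X\<in>\<X>. brick C X) \<and>
     (\<forall>X\<in>\<X>. \<forall>Y\<in>\<X>. \<not> isomorphic C X Y \<longrightarrow> arr C X Y = {\<zero>\<^bsub>Hom C X Y\<^esub>})"

text \<open>
  Subsets of a set of isoclasses of objects of T. The closure under isomorphisms is essential: it
  is what makes two subsets equal if they contain the same isoclasses.
\<close>

definition iso_subsets :: "('o, 'm, 'k, 'z) lin_cat_scheme \<Rightarrow> 'o set \<Rightarrow> 'o set set" where
  "iso_subsets T \<X> = {\<Y>. \<Y> \<subseteq> \<X> \<and> subcategory T \<Y>}"

definition filtration_subcategory ::
  "('o, 'm, 'k, 'e, 'z) extri_cat_scheme \<Rightarrow> 'o set \<Rightarrow> 'o set \<Rightarrow> bool" where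
  "filtration_subcategory T \<X> \<U> \<longleftrightarrow> (\<exists>\<Y>\<in>iso_subsets T \<X>. \<U> = Filt T \<Y>)"

text \<open>
  The subset of \<open>\<X>\<close> that generates the smallest filtration subcategory containing \<open>\<D>\<close>.
\<close>

definition supp :: "('o, 'm, 'k, 'e, 'z) extri_cat_scheme \<Rightarrow> 'o set \<Rightarrow> 'o set \<Rightarrow> 'o set" where
  "supp T \<X> \<D> = (THE \<S>. \<S> \<in> iso_subsets T \<X> \<and> \<D> \<subseteq> Filt T \<S> \<and>
     (\<forall>\<U>. filtration_subcategory T \<X> \<U> \<and> \<D> \<subseteq> \<U> \<longrightarrow> Filt T \<S> \<subseteq> \<U>))"

end

theory Submission
  imports Defs
begin

text \<open>
  Write \<open>T\<close> for \<open>Filt C \<X>\<close>. The proof treats the bricks in \<open>\<X>\<close> as the simple objects of \<open>T\<close>: a nonzero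
  morphism from an object of \<open>T\<close> to a brick in \<open>\<X>\<close> is a deflation, and its cocone has a filtration with
  one step less (\<open>nonzero_to_brick_deflation\<close>). There is no Jordan-Hoelder theorem behind this, and
  even the zero object may have nontrivial filtrations, but peeling off bricks one at a time suffices
  for inductions. Such inductions show that an object lying in \<open>Filt \<S>\<close> for all \<open>\<S>\<close> in a family lies
  in \<open>Filt\<close> of the intersection (\<open>Filt_Inter\<close>), so that \<open>supp\<close> is left adjoint to \<open>Filt\<close>
  (\<open>supp_subset_iff\<close>), and that \<open>Filt \<S>\<close> is closed under retracts (\<open>Filt_retract\<close>). As a brick of \<open>\<X>\<close>
  in \<open>Filt \<S>\<close> belongs to \<open>\<S>\<close>, the maps \<open>supp\<close> and \<open>Filt\<close> are inverse to each other between the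
  filtration subcategories and the subsets of \<open>\<X>\<close>.

  It remains to see that \<open>(\<U>, \<U>\<^sup>\<bottom>)\<close> with \<open>\<U> = Filt \<S>\<close> is a cotorsion pair exactly if \<open>\<U>\<close> contains the
  projectives (\<open>cotorsion_pair_iff\<close>). In a cotorsion pair, a projective object \<open>P\<close> is a retract of the
  middle term of a conflation \<open>V \<rightarrow> U \<rightarrow> P\<close>, hence lies in \<open>\<U>\<close>. For the converse, every object \<open>B\<close> of
  \<open>T\<close> has a conflation \<open>U \<rightarrow> B \<rightarrow> F\<close> with \<open>U\<close> in \<open>\<U>\<close> and \<open>Hom(\<U>, F) = 0\<close>
  (\<open>torsion_decomposition\<close>). Take \<open>B\<close> to be the cone of an inflation \<open>M \<rightarrow> I\<close> with \<open>I\<close> injective, and let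
  \<open>G\<close> be the cocone of the composite \<open>I \<rightarrow> B \<rightarrow> F\<close>. Then there is a conflation \<open>M \<rightarrow> G \<rightarrow> U\<close>, and
  \<open>E(\<U>, G) = 0\<close> because it sits between \<open>Hom(\<U>, F) = 0\<close> and \<open>E(\<U>, I) = 0\<close>. The conflations
  \<open>V \<rightarrow> U \<rightarrow> M\<close> follow by the argument of Salce: in a conflation \<open>A \<rightarrow> P \<rightarrow> M\<close> with \<open>P\<close> projective, push
  out along \<open>A \<rightarrow> G\<close>, where \<open>A \<rightarrow> G \<rightarrow> U\<close> is the conflation just found. The result is \<open>G \<rightarrow> N \<rightarrow> M\<close>, where
  \<open>N\<close> is an extension of \<open>U\<close> by \<open>P\<close>, so this is where \<open>\<U>\<close> has to contain the projectives.
\<close>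

section \<open>Morphisms in linear categories\<close>


lemma (in abelian_group) add_idem_imp_zero:
  assumes "a \<in> carrier G" "a \<oplus> a = a" shows "a = \<zero>"
  using assms by (metis add.r_cancel_one' )

context linear_category
begin


text \<open>
  Nothing is known about \<open>Hom C A B\<close> unless \<open>A\<close> and \<open>B\<close> are objects, so the two memberships are
  carried along with every morphism.
\<close>

definition mor :: "'m \<Rightarrow> 'o \<Rightarrow> 'o \<Rightarrow> bool" where
  "mor f A B \<longleftrightarrow> A \<in> objs C \<and> B \<in> objs C \<and> f \<in> arr C A B"

abbreviation zmor :: "'o \<Rightarrow> 'o \<Rightarrow> 'm" where
  "zmor A B \<equiv> \<zero>\<^bsub>Hom C A B\<^esub>"

lemma morD: "mor f A B \<Longrightarrow> A \<in> objs C" "mor f A B \<Longrightarrow> B \<in> objs C" "mor f A B \<Longrightarrow> f \<in> arr C A B"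
  by (auto simp: mor_def)

lemma hom_group: "\<lbrakk>A \<in> objs C; B \<in> objs C\<rbrakk> \<Longrightarrow> abelian_group (Hom C A B)"
  using hom_module by (simp add: module_def)

lemma hom_group_mor: "mor f A B \<Longrightarrow> abelian_group (Hom C A B)"
  by (auto simp: mor_def hom_group)

lemma mor_zero: "\<lbrakk>A \<in> objs C; B \<in> objs C\<rbrakk> \<Longrightarrow> mor (zmor A B) A B"
  using hom_group by (auto simp: mor_def abelian_group.axioms abelian_monoid.zero_closed abelian_group.axioms(1))

lemma mor_ident: "A \<in> objs C \<Longrightarrow> mor (ident C A) A A"
  by (simp add: mor_def ident_closed)

lemma mor_cmp: "\<lbrakk>mor f A B; mor g B D\<rbrakk> \<Longrightarrow> mor (g \<cdot>\<^bsub>C\<^esub> f) A D"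
  by (auto simp: mor_def intro: cmp_closed)

lemma mor_minus: "\<lbrakk>mor f A B; mor g A B\<rbrakk> \<Longrightarrow> mor (f \<ominus>\<^bsub>Hom C A B\<^esub> g) A B"
  using hom_group by (auto simp: mor_def abelian_group.minus_closed)

lemma mor_assoc: "\<lbrakk>mor f A B; mor g B D; mor h D E\<rbrakk> \<Longrightarrow> (h \<cdot>\<^bsub>C\<^esub> g) \<cdot>\<^bsub>C\<^esub> f = h \<cdot>\<^bsub>C\<^esub> (g \<cdot>\<^bsub>C\<^esub> f)"
  using cmp_assoc by (auto simp: mor_def)

lemma id_right: "mor f A B \<Longrightarrow> f \<cdot>\<^bsub>C\<^esub> ident C A = f"
  by (auto simp: mor_def ident_right)

lemma id_left: "mor f A B \<Longrightarrow> ident C B \<cdot>\<^bsub>C\<^esub> f = f"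
  by (auto simp: mor_def ident_left)

lemma cmp_zero_right:
  assumes "A \<in> objs C" "mor g B D" shows "g \<cdot>\<^bsub>C\<^esub> zmor A B = zmor A D"
proof -
  have B: "B \<in> objs C" and D: "D \<in> objs C" using assms by (auto simp: mor_def)
  interpret AB: abelian_group "Hom C A B" using assms B by (simp add: hom_group)
  interpret AD: abelian_group "Hom C A D" using assms D by (simp add: hom_group)
  have m: "mor (g \<cdot>\<^bsub>C\<^esub> zmor A B) A D" using mor_cmp mor_zero assms B by blast
  have "g \<cdot>\<^bsub>C\<^esub> (zmor A B \<oplus>\<^bsub>Hom C A B\<^esub> zmor A B) = (g \<cdot>\<^bsub>C\<^esub> zmor A B) \<oplus>\<^bsub>Hom C A D\<^esub> (g \<cdot>\<^bsub>C\<^esub> zmor A B)"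
    using assms B D by (intro cmp_add_right) (auto simp: mor_def)
  then show ?thesis using m AD.add_idem_imp_zero by (simp add: mor_def)
qed

lemma cmp_zero_left:
  assumes "D \<in> objs C" "mor f A B" shows "zmor B D \<cdot>\<^bsub>C\<^esub> f = zmor A D"
proof -
  have B: "B \<in> objs C" and A: "A \<in> objs C" using assms by (auto simp: mor_def)
  interpret BD: abelian_group "Hom C B D" using assms B by (simp add: hom_group)
  interpret AD: abelian_group "Hom C A D" using assms A by (simp add: hom_group)
  have m: "mor (zmor B D \<cdot>\<^bsub>C\<^esub> f) A D" using mor_cmp mor_zero assms B by blast
  have "(zmor B D \<oplus>\<^bsub>Hom C B D\<^esub> zmor B D) \<cdot>\<^bsub>C\<^esub> f = (zmor B D \<cdot>\<^bsub>C\<^esub> f) \<oplus>\<^bsub>Hom C A D\<^esub> (zmor B D \<cdot>\<^bsub>C\<^esub> f)"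
    using assms A B by (intro cmp_add_left) (auto simp: mor_def)
  then show ?thesis using m AD.add_idem_imp_zero by (simp add: mor_def)
qed

lemma minus_zero_iff:
  assumes "mor f A B" "mor g A B"
  shows "f \<ominus>\<^bsub>Hom C A B\<^esub> g = zmor A B \<longleftrightarrow> f = g"
proof -
  interpret abelian_group "Hom C A B" using assms hom_group_mor by blast
  show ?thesis using assms
    by (metis a_inv_closed add.inv_closed add.inv_equality l_neg minus_eq minus_minus mor_def r_neg)
qed

lemma minus_plus:
  assumes "mor f A B" "mor g A B"
  shows "(f \<ominus>\<^bsub>Hom C A B\<^esub> g) \<oplus>\<^bsub>Hom C A B\<^esub> g = f"
proof -
  interpret abelian_group "Hom C A B" using assms hom_group_mor by blast
  show ?thesis using assms
    by (simp add: minus_eq a_assoc l_neg mor_def)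
qed

lemma diff_unique:
  assumes "mor f A B" "mor g A B" "mor h A B" "h \<oplus>\<^bsub>Hom C A B\<^esub> g = f"
  shows "h = f \<ominus>\<^bsub>Hom C A B\<^esub> g"
proof -
  interpret abelian_group "Hom C A B" using assms hom_group_mor by blast
  show ?thesis using assms
    by (metis a_assoc a_inv_closed minus_eq morD(3) r_neg r_zero)
qed

lemma minus_of_zero:
  assumes "mor f A B" shows "f \<ominus>\<^bsub>Hom C A B\<^esub> zmor A B = f"
proof -
  interpret abelian_group "Hom C A B" by (rule hom_group_mor[OF assms])
  show ?thesis using diff_unique[OF assms mor_zero assms, symmetric] morD[OF assms] by simp
qed

lemma add_right: "\<lbrakk>mor f A B; mor f' A B; mor g B D\<rbrakk>
    \<Longrightarrow> g \<cdot>\<^bsub>C\<^esub> (f \<oplus>\<^bsub>Hom C A B\<^esub> f') = (g \<cdot>\<^bsub>C\<^esub> f) \<oplus>\<^bsub>Hom C A D\<^esub> (g \<cdot>\<^bsub>C\<^esub> f')"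
  by (intro cmp_add_right) (auto simp: mor_def)

lemma add_left: "\<lbrakk>mor f A B; mor g B D; mor g' B D\<rbrakk>
    \<Longrightarrow> (g \<oplus>\<^bsub>Hom C B D\<^esub> g') \<cdot>\<^bsub>C\<^esub> f = (g \<cdot>\<^bsub>C\<^esub> f) \<oplus>\<^bsub>Hom C A D\<^esub> (g' \<cdot>\<^bsub>C\<^esub> f)"
  by (intro cmp_add_left) (auto simp: mor_def)

lemma minus_right:
  assumes "mor f A B" "mor f' A B" "mor g B D"
  shows "g \<cdot>\<^bsub>C\<^esub> (f \<ominus>\<^bsub>Hom C A B\<^esub> f') = (g \<cdot>\<^bsub>C\<^esub> f) \<ominus>\<^bsub>Hom C A D\<^esub> (g \<cdot>\<^bsub>C\<^esub> f')"
proof (rule diff_unique)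
  show "g \<cdot>\<^bsub>C\<^esub> (f \<ominus>\<^bsub>Hom C A B\<^esub> f') \<oplus>\<^bsub>Hom C A D\<^esub> g \<cdot>\<^bsub>C\<^esub> f' = g \<cdot>\<^bsub>C\<^esub> f"
    using assms by (metis add_right minus_plus mor_minus)
qed (use assms mor_cmp mor_minus in blast)+

lemma minus_left:
  assumes "mor f A B" "mor g B D" "mor g' B D"
  shows "(g \<ominus>\<^bsub>Hom C B D\<^esub> g') \<cdot>\<^bsub>C\<^esub> f = (g \<cdot>\<^bsub>C\<^esub> f) \<ominus>\<^bsub>Hom C A D\<^esub> (g' \<cdot>\<^bsub>C\<^esub> f)"
proof (rule diff_unique)
  show "(g \<ominus>\<^bsub>Hom C B D\<^esub> g') \<cdot>\<^bsub>C\<^esub> f \<oplus>\<^bsub>Hom C A D\<^esub> g' \<cdot>\<^bsub>C\<^esub> f = g \<cdot>\<^bsub>C\<^esub> f"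
    using assms by (metis add_left minus_plus mor_minus)
qed (use assms mor_cmp mor_minus in blast)+

lemma zero_object_iff: "zero_object C Z \<longleftrightarrow> Z \<in> objs C \<and> ident C Z = zmor Z Z"
proof (intro iffI conjI)
  assume "zero_object C Z"
  then show "Z \<in> objs C" "ident C Z = zmor Z Z" using ident_closed by (auto simp: zero_object_def)
next
  assume a: "Z \<in> objs C \<and> ident C Z = zmor Z Z"
  have "f = zmor Z A" if "A \<in> objs C" "f \<in> arr C Z A" for f A
    using that a by (metis cmp_zero_right id_right mor_def)
  moreover have "f = zmor A Z" if "A \<in> objs C" "f \<in> arr C A Z" for f A
    using that a by (metis cmp_zero_left id_left mor_def)
  ultimately show "zero_object C Z" unfolding zero_object_def
    using a mor_zero morD(3) by blast
qed

lemma zero_object_from: "\<lbrakk>zero_object C Z; mor f Z A\<rbrakk> \<Longrightarrow> f = zmor Z A"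
  and zero_object_to: "\<lbrakk>zero_object C Z; mor f A Z\<rbrakk> \<Longrightarrow> f = zmor A Z"
  by (auto simp: zero_object_def mor_def)

lemma isoI: "\<lbrakk>mor f A B; mor g B A; g \<cdot>\<^bsub>C\<^esub> f = ident C A; f \<cdot>\<^bsub>C\<^esub> g = ident C B\<rbrakk> \<Longrightarrow> isomorphism C A B f"
  by (auto simp: isomorphism_def mor_def)

lemma isoE:
  assumes "isomorphism C A B f" "A \<in> objs C" "B \<in> objs C"
  obtains g where "mor f A B" "mor g B A" "g \<cdot>\<^bsub>C\<^esub> f = ident C A" "f \<cdot>\<^bsub>C\<^esub> g = ident C B"
    "isomorphism C B A g"
  using assms by (auto simp: isomorphism_def mor_def)

lemma iso_cmp:
  assumes "isomorphism C A B f" "isomorphism C B D g" "A \<in> objs C" "B \<in> objs C" "D \<in> objs C"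
  shows "isomorphism C A D (g \<cdot>\<^bsub>C\<^esub> f)"
proof -
  obtain f' where f: "mor f A B" "mor f' B A" "f' \<cdot>\<^bsub>C\<^esub> f = ident C A" "f \<cdot>\<^bsub>C\<^esub> f' = ident C B"
    using isoE assms by metis
  obtain g' where g: "mor g B D" "mor g' D B" "g' \<cdot>\<^bsub>C\<^esub> g = ident C B" "g \<cdot>\<^bsub>C\<^esub> g' = ident C D"
    using isoE assms by metis
  have "(f' \<cdot>\<^bsub>C\<^esub> g') \<cdot>\<^bsub>C\<^esub> (g \<cdot>\<^bsub>C\<^esub> f) = f' \<cdot>\<^bsub>C\<^esub> ((g' \<cdot>\<^bsub>C\<^esub> g) \<cdot>\<^bsub>C\<^esub> f)"
    using mor_assoc[OF mor_cmp[OF f(1) g(1)] g(2) f(2)] mor_assoc[OF f(1) g(1) g(2)] by simp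
  moreover have "(g \<cdot>\<^bsub>C\<^esub> f) \<cdot>\<^bsub>C\<^esub> (f' \<cdot>\<^bsub>C\<^esub> g') = g \<cdot>\<^bsub>C\<^esub> ((f \<cdot>\<^bsub>C\<^esub> f') \<cdot>\<^bsub>C\<^esub> g')"
    using mor_assoc[OF mor_cmp[OF g(2) f(2)] f(1) g(1)] mor_assoc[OF g(2) f(2) f(1)] by simp
  ultimately show ?thesis using f g by (intro isoI[of _ _ _ "f' \<cdot>\<^bsub>C\<^esub> g'"]) (auto simp: id_left id_right intro: mor_cmp)
qed

text \<open>
  The inverse of \<open>1 + n\<close> is \<open>1 - n\<close>. The comparisons of triangles below produce isomorphisms in this
  way; it takes the place of a five lemma.
\<close>

lemma iso_of_square_zero:
  assumes u: "mor u A A" and n: "n = u \<ominus>\<^bsub>Hom C A A\<^esub> ident C A" and nn: "n \<cdot>\<^bsub>C\<^esub> n = zmor A A"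
  shows "isomorphism C A A u"
proof -
  have A: "A \<in> objs C" using u by (simp add: mor_def)
  interpret abelian_group "Hom C A A" using A by (simp add: hom_group)
  have mn: "mor n A A" using n u A by (simp add: mor_minus mor_ident)
  define v where "v = ident C A \<ominus>\<^bsub>Hom C A A\<^esub> n"
  have mv: "mor v A A" unfolding v_def using mn A by (simp add: mor_minus mor_ident)
  have uu: "u = n \<oplus>\<^bsub>Hom C A A\<^esub> ident C A" unfolding n using u A by (simp add: minus_plus mor_ident)
  have un: "u \<cdot>\<^bsub>C\<^esub> n = n" unfolding uu using mn A mor_ident[OF A] nn add_left id_left l_zero morD(3)
    by (metis)
  have nu: "n \<cdot>\<^bsub>C\<^esub> u = n" unfolding uu using mn A mor_ident[OF A] nn add_right id_right l_zero morD(3)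
    by (metis)
  have cancel: "u \<ominus>\<^bsub>Hom C A A\<^esub> n = ident C A"
    using diff_unique[OF u mn mor_ident[OF A]] uu a_comm[OF morD(3)[OF mn] ident_closed[OF A]] by simp
  have "u \<cdot>\<^bsub>C\<^esub> v = u \<ominus>\<^bsub>Hom C A A\<^esub> n"
    unfolding v_def using minus_right[OF mor_ident[OF A] mn u] un id_right[OF u] by simp
  moreover have "v \<cdot>\<^bsub>C\<^esub> u = u \<ominus>\<^bsub>Hom C A A\<^esub> n"
    unfolding v_def using minus_left[OF u mor_ident[OF A] mn] nu id_left[OF u] by simp
  ultimately show ?thesis using isoI[OF u mv] cancel by simp
qed

lemma iso_of_iso_comps:
  assumes f: "mor f A B" and g: "mor g B A"
    and gf: "isomorphism C A A (g \<cdot>\<^bsub>C\<^esub> f)" and fg: "isomorphism C B B (f \<cdot>\<^bsub>C\<^esub> g)"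
  shows "isomorphism C A B f"
proof -
  have A: "A \<in> objs C" and B: "B \<in> objs C" using f morD by blast+
  obtain u where u: "mor u A A" "u \<cdot>\<^bsub>C\<^esub> (g \<cdot>\<^bsub>C\<^esub> f) = ident C A" using isoE[OF gf A A] by metis
  obtain v where v: "mor v B B" "(f \<cdot>\<^bsub>C\<^esub> g) \<cdot>\<^bsub>C\<^esub> v = ident C B" using isoE[OF fg B B] by metis
  let ?l = "u \<cdot>\<^bsub>C\<^esub> g" and ?r = "g \<cdot>\<^bsub>C\<^esub> v"
  have l: "mor ?l B A" "?l \<cdot>\<^bsub>C\<^esub> f = ident C A" using mor_cmp[OF g u(1)] mor_assoc[OF f g u(1)] u(2) by simp_all
  have r: "mor ?r B A" "f \<cdot>\<^bsub>C\<^esub> ?r = ident C B" using mor_cmp[OF v(1) g] mor_assoc[OF v(1) g f] v(2) by simp_all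
  have "?l = ?r" using mor_assoc[OF r(1) f l(1)] l(2) r(2) id_left[OF r(1)] id_right[OF l(1)] by simp
  then show ?thesis using isoI[OF f r(1)] l(2) r(2) by simp
qed

end


section \<open>Triangles and their exact sequences\<close>


context extriangulated_category
begin


abbreviation zext :: "'o \<Rightarrow> 'o \<Rightarrow> 'e" where
  "zext Z A \<equiv> \<zero>\<^bsub>EE C Z A\<^esub>"

lemmas bifunctor_laws =
  biadditive_functor[unfolded biadditive_functor_def, THEN conjunct1]
  biadditive_functor[unfolded biadditive_functor_def, THEN conjunct2, THEN conjunct1]
  biadditive_functor[unfolded biadditive_functor_def, THEN conjunct2, THEN conjunct2, THEN conjunct1]
  biadditive_functor[unfolded biadditive_functor_def, THEN conjunct2, THEN conjunct2, THEN conjunct2, THEN conjunct1]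
  biadditive_functor[unfolded biadditive_functor_def, THEN conjunct2, THEN conjunct2, THEN conjunct2, THEN conjunct2, THEN conjunct1]
  biadditive_functor[unfolded biadditive_functor_def, THEN conjunct2, THEN conjunct2, THEN conjunct2, THEN conjunct2, THEN conjunct2, THEN conjunct1]
  biadditive_functor[unfolded biadditive_functor_def, THEN conjunct2, THEN conjunct2, THEN conjunct2, THEN conjunct2, THEN conjunct2, THEN conjunct2, THEN conjunct1]
  biadditive_functor[unfolded biadditive_functor_def, THEN conjunct2, THEN conjunct2, THEN conjunct2, THEN conjunct2, THEN conjunct2, THEN conjunct2, THEN conjunct2, THEN conjunct1]
  biadditive_functor[unfolded biadditive_functor_def, THEN conjunct2, THEN conjunct2, THEN conjunct2, THEN conjunct2, THEN conjunct2, THEN conjunct2, THEN conjunct2, THEN conjunct2]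

lemma ext_group: "\<lbrakk>A \<in> objs C; Z \<in> objs C\<rbrakk> \<Longrightarrow> abelian_group (EE C Z A)"
  by (rule bifunctor_laws(1)[rule_format])

lemma zext_closed: "\<lbrakk>A \<in> objs C; Z \<in> objs C\<rbrakk> \<Longrightarrow> zext Z A \<in> exts C Z A"
  by (rule abelian_monoid.zero_closed[OF abelian_group.axioms(1)[OF ext_group]])

lemma push_hom: "\<lbrakk>mor a A A'; Z \<in> objs C\<rbrakk>
    \<Longrightarrow> abelian_group_hom (EE C Z A) (EE C Z A') (push C Z a)"
  by (rule bifunctor_laws(2)[rule_format]) (auto simp: mor_def)

lemma pull_hom: "\<lbrakk>mor c Z' Z; A \<in> objs C\<rbrakk>
    \<Longrightarrow> abelian_group_hom (EE C Z A) (EE C Z' A) (pull C c A)"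
  by (rule bifunctor_laws(3)[rule_format]) (auto simp: mor_def)

lemma push_closed: "\<lbrakk>mor a A A'; Z \<in> objs C; d \<in> exts C Z A\<rbrakk> \<Longrightarrow> push C Z a d \<in> exts C Z A'"
  by (rule abelian_group_hom.hom_closed[OF push_hom])

lemma pull_closed: "\<lbrakk>mor c Z' Z; A \<in> objs C; d \<in> exts C Z A\<rbrakk> \<Longrightarrow> pull C c A d \<in> exts C Z' A"
  by (rule abelian_group_hom.hom_closed[OF pull_hom])

lemma push_zext: "\<lbrakk>mor a A A'; Z \<in> objs C\<rbrakk> \<Longrightarrow> push C Z a (zext Z A) = zext Z A'"
  by (rule abelian_group_hom.hom_zero[OF push_hom])

lemma pull_zext: "\<lbrakk>mor c Z' Z; A \<in> objs C\<rbrakk> \<Longrightarrow> pull C c A (zext Z A) = zext Z' A"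
  by (rule abelian_group_hom.hom_zero[OF pull_hom])

lemma pull_plus: "\<lbrakk>mor c Z' Z; A \<in> objs C; d \<in> exts C Z A; d' \<in> exts C Z A\<rbrakk>
    \<Longrightarrow> pull C c A (d \<oplus>\<^bsub>EE C Z A\<^esub> d') = pull C c A d \<oplus>\<^bsub>EE C Z' A\<^esub> pull C c A d'"
  by (rule abelian_group_hom.hom_add[OF pull_hom])

lemma push_ident: "\<lbrakk>A \<in> objs C; Z \<in> objs C; d \<in> exts C Z A\<rbrakk> \<Longrightarrow> push C Z (ident C A) d = d"
  by (rule bifunctor_laws(4)[rule_format, THEN conjunct1])

lemma pull_ident: "\<lbrakk>A \<in> objs C; Z \<in> objs C; d \<in> exts C Z A\<rbrakk> \<Longrightarrow> pull C (ident C Z) A d = d"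
  by (rule bifunctor_laws(4)[rule_format, THEN conjunct2])

lemma push_cmp: "\<lbrakk>mor a A A'; mor a' A' A''; Z \<in> objs C; d \<in> exts C Z A\<rbrakk>
    \<Longrightarrow> push C Z (a' \<cdot>\<^bsub>C\<^esub> a) d = push C Z a' (push C Z a d)"
  by (rule bifunctor_laws(5)[rule_format, of A A' A'' Z a a' d]) (auto simp: mor_def)

lemma pull_cmp: "\<lbrakk>mor c Z' Z; mor c' Z'' Z'; A \<in> objs C; d \<in> exts C Z A\<rbrakk>
    \<Longrightarrow> pull C (c \<cdot>\<^bsub>C\<^esub> c') A d = pull C c' A (pull C c A d)"
  by (rule bifunctor_laws(6)[rule_format, of A Z Z' Z'' c c' d]) (auto simp: mor_def)

lemma push_add: "\<lbrakk>mor a A A'; mor b A A'; Z \<in> objs C; d \<in> exts C Z A\<rbrakk>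
    \<Longrightarrow> push C Z (a \<oplus>\<^bsub>Hom C A A'\<^esub> b) d = push C Z a d \<oplus>\<^bsub>EE C Z A'\<^esub> push C Z b d"
  by (rule bifunctor_laws(8)[rule_format, of A A' Z a b d]) (auto simp: mor_def)

lemma pull_add: "\<lbrakk>mor c Z' Z; mor b Z' Z; A \<in> objs C; d \<in> exts C Z A\<rbrakk>
    \<Longrightarrow> pull C (c \<oplus>\<^bsub>Hom C Z' Z\<^esub> b) A d = pull C c A d \<oplus>\<^bsub>EE C Z' A\<^esub> pull C b A d"
  by (rule bifunctor_laws(9)[rule_format, of A Z Z' c b d]) (auto simp: mor_def)

lemma pull_zmor:
  assumes "A \<in> objs C" "Z' \<in> objs C" "Z \<in> objs C" "d \<in> exts C Z A"
  shows "pull C (zmor Z' Z) A d = zext Z' A"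
proof -
  interpret H: abelian_group "Hom C Z' Z" by (rule hom_group[OF assms(2,3)])
  interpret E: abelian_group "EE C Z' A" by (rule ext_group[OF assms(1,2)])
  have z: "mor (zmor Z' Z) Z' Z" using assms mor_zero by blast
  show ?thesis
    using pull_add[OF z z assms(1,4)] E.add_idem_imp_zero[OF pull_closed[OF z assms(1,4)]]
    by (metis H.l_zero H.zero_closed)
qed

lemma push_diff:
  assumes "mor a A A'" "mor b A A'" "Z \<in> objs C" "d \<in> exts C Z A" "push C Z a d = push C Z b d"
  shows "push C Z (a \<ominus>\<^bsub>Hom C A A'\<^esub> b) d = zext Z A'"
proof -
  interpret E: abelian_group "EE C Z A'" using assms ext_group by (auto simp: mor_def)
  have m: "mor (a \<ominus>\<^bsub>Hom C A A'\<^esub> b) A A'" using assms mor_minus by blast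
  have "push C Z (a \<ominus>\<^bsub>Hom C A A'\<^esub> b) d \<oplus>\<^bsub>EE C Z A'\<^esub> push C Z b d = push C Z b d"
    using push_add[OF m assms(2-4)] minus_plus[OF assms(1,2)] assms(5) by simp
  then show ?thesis
    using push_closed[OF m] push_closed[OF assms(2)] assms(3,4) by simp
qed

lemmas realization_laws =
  additive_realization[unfolded additive_realization_def realization_def, THEN conjunct1, THEN conjunct1]
  additive_realization[unfolded additive_realization_def realization_def, THEN conjunct1, THEN conjunct2]
  additive_realization[unfolded additive_realization_def realization_def, THEN conjunct2, THEN conjunct1]

lemma etriD:
  assumes "etriangle C A x B y Z d"
  shows "A \<in> objs C" "B \<in> objs C" "Z \<in> objs C" "mor x A B" "mor y B Z" "d \<in> exts C Z A"
  using assms by (auto simp: etriangle_def mor_def)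

text \<open>
  A representative of the class \<open>rlz C Z A d\<close> is itself a member, since sequence equivalence is
  reflexive.
\<close>

lemma rlz_class:
  assumes "A \<in> objs C" "Z \<in> objs C" "d \<in> exts C Z A"
  obtains x B y where "etriangle C A x B y Z d" "rlz C Z A d = {s. seq_equiv C A Z (x, y) s}"
proof -
  obtain B x y where B: "B \<in> objs C" "x \<in> arr C A B" "y \<in> arr C B Z"
    and r: "rlz C Z A d = {s. seq_equiv C A Z (x, y) s}"
    using bspec[OF bspec[OF bspec[OF realization_laws(1) assms(1)] assms(2)] assms(3)] by (elim bexE)
  have "seq_equiv C A Z (x, y) (x, y)"
    using B assms isoI[OF mor_ident mor_ident] by (auto simp: seq_equiv_def mor_ident id_left[OF mor_ident]
        ident_left ident_right intro!: bexI[of _ B] exI[of _ "ident C B"])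
  then show thesis using that B r assms by (auto simp: etriangle_def)
qed

lemma etri_realize:
  assumes "A \<in> objs C" "Z \<in> objs C" "d \<in> exts C Z A"
  obtains x B y where "etriangle C A x B y Z d"
  by (rule rlz_class[OF assms])

lemma etri_morphism:
  assumes "etriangle C A x B y Z d" "etriangle C A' x' B' y' Z' d'"
    and "mor a A A'" "mor c Z Z'" "push C Z a d = pull C c A' d'"
  obtains b where "mor b B B'" "b \<cdot>\<^bsub>C\<^esub> x = x' \<cdot>\<^bsub>C\<^esub> a" "y' \<cdot>\<^bsub>C\<^esub> b = c \<cdot>\<^bsub>C\<^esub> y"
proof -
  have "\<exists>b\<in>arr C B B'. b \<cdot>\<^bsub>C\<^esub> x = x' \<cdot>\<^bsub>C\<^esub> a \<and> y' \<cdot>\<^bsub>C\<^esub> b = c \<cdot>\<^bsub>C\<^esub> y"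
    by (rule realization_laws(2)[rule_format, of A x B y Z d A' x' B' y' Z' d' a c]) (use assms in \<open>simp add: mor_def\<close>)
  then show thesis using that etriD[OF assms(1)] etriD[OF assms(2)] by (auto simp: mor_def)
qed

lemma etri_ET3:
  assumes "etriangle C A x B y Z d" "etriangle C A' x' B' y' Z' d'"
    and "mor a A A'" "mor b B B'" "b \<cdot>\<^bsub>C\<^esub> x = x' \<cdot>\<^bsub>C\<^esub> a"
  obtains c where "mor c Z Z'" "y' \<cdot>\<^bsub>C\<^esub> b = c \<cdot>\<^bsub>C\<^esub> y" "push C Z a d = pull C c A' d'"
proof -
  have "\<exists>c\<in>arr C Z Z'. y' \<cdot>\<^bsub>C\<^esub> b = c \<cdot>\<^bsub>C\<^esub> y \<and> push C Z a d = pull C c A' d'"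
    by (rule ET3[unfolded ET3_def, rule_format, of A x B y Z d A' x' B' y' Z' d' a b]) (use assms in \<open>simp add: mor_def\<close>)
  then show thesis using that etriD[OF assms(1)] etriD[OF assms(2)] by (auto simp: mor_def)
qed

lemma etri_ET3_op:
  assumes "etriangle C A x B y Z d" "etriangle C A' x' B' y' Z' d'"
    and "mor b B B'" "mor c Z Z'" "y' \<cdot>\<^bsub>C\<^esub> b = c \<cdot>\<^bsub>C\<^esub> y"
  obtains a where "mor a A A'" "b \<cdot>\<^bsub>C\<^esub> x = x' \<cdot>\<^bsub>C\<^esub> a" "push C Z a d = pull C c A' d'"
proof -
  have "\<exists>a\<in>arr C A A'. b \<cdot>\<^bsub>C\<^esub> x = x' \<cdot>\<^bsub>C\<^esub> a \<and> push C Z a d = pull C c A' d'"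
    by (rule ET3_op[unfolded ET3_op_def, rule_format, of A x B y Z d A' x' B' y' Z' d' b c]) (use assms in \<open>simp add: mor_def\<close>)
  then show thesis using that etriD[OF assms(1)] etriD[OF assms(2)] by (auto simp: mor_def)
qed

lemma etri_ET4:
  assumes "etriangle C A f B f' D d1" "etriangle C B g H g' G d2"
  obtains F h' d e d3 where "mor h' H F" "h' \<cdot>\<^bsub>C\<^esub> g = d \<cdot>\<^bsub>C\<^esub> f'" "e \<cdot>\<^bsub>C\<^esub> h' = g'"
    "etriangle C A (g \<cdot>\<^bsub>C\<^esub> f) H h' F d3" "etriangle C D d F e G (push C G f' d2)"
    "pull C d A d3 = d1" "push C F f d3 = pull C e B d2"
  using ET4[unfolded ET4_def, rule_format, OF conjI, OF assms] etriD[OF assms(2)]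
  by (auto simp: mor_def)

lemma etri_ET4_op:
  assumes "etriangle C D f' B f A d1" "etriangle C G g' H g B d2"
  obtains F h' d e d3 where "mor h' F H" "g \<cdot>\<^bsub>C\<^esub> h' = f' \<cdot>\<^bsub>C\<^esub> d" "h' \<cdot>\<^bsub>C\<^esub> e = g'"
    "etriangle C F h' H (f \<cdot>\<^bsub>C\<^esub> g) A d3" "etriangle C G e F d D (pull C f' G d2)"
    "push C A d d3 = d1" "pull C f F d3 = push C B e d2"
  using ET4_op[unfolded ET4_op_def, rule_format, OF conjI, OF assms] etriD[OF assms(2)]
  by (auto simp: mor_def)

lemma split_etri: "biproduct C A Z B i i' p p' \<Longrightarrow> etriangle C A i B p' Z (zext Z A)"
  by (rule realization_laws(3)[rule_format])

lemma biproductD: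
  assumes "biproduct C A A' S i i' p p'"
  shows "mor i A S" "mor i' A' S" "mor p S A" "mor p' S A'" "p \<cdot>\<^bsub>C\<^esub> i = ident C A" "p' \<cdot>\<^bsub>C\<^esub> i' = ident C A'"
    "p \<cdot>\<^bsub>C\<^esub> i' = zmor A' A" "p' \<cdot>\<^bsub>C\<^esub> i = zmor A A'" "S \<in> objs C"
  using assms by (auto simp: biproduct_def mor_def)

lemma biproduct_swap:
  assumes "biproduct C A Z B i i' p p'" shows "biproduct C Z A B i' i p' p"
proof -
  interpret abelian_group "Hom C B B" using assms hom_group unfolding biproduct_def by blast
  show ?thesis using assms unfolding biproduct_def
    by (metis a_comm cmp_closed)
qed

lemma biproduct_zero_right:
  assumes "A \<in> objs C" "zero_object C Z"
  shows "biproduct C A Z A (ident C A) (zmor Z A) (ident C A) (zmor A Z)"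
proof -
  have Z: "Z \<in> objs C" "ident C Z = zmor Z Z" using assms zero_object_iff by auto
  interpret abelian_group "Hom C A A" using assms hom_group by blast
  have "zmor Z A \<cdot>\<^bsub>C\<^esub> zmor A Z = zmor A A"
    by (rule cmp_zero_right[OF assms(1) mor_zero[OF Z(1) assms(1)]])
  then have "ident C A \<cdot>\<^bsub>C\<^esub> ident C A \<oplus>\<^bsub>Hom C A A\<^esub> zmor Z A \<cdot>\<^bsub>C\<^esub> zmor A Z = ident C A"
    using id_left[OF mor_ident[OF assms(1)]] ident_closed[OF assms(1)] by simp
  moreover have "zmor A Z \<cdot>\<^bsub>C\<^esub> zmor Z A = ident C Z"
    using cmp_zero_left[OF Z(1) mor_zero[OF Z(1) assms(1)]] Z(2) by simp
  ultimately show ?thesis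
    unfolding biproduct_def using assms(1) Z(1) mor_zero[THEN morD(3)] ident_closed
      id_left[OF mor_ident] id_left[OF mor_zero] id_right[OF mor_zero] by auto
qed

lemma etri_id_left: "\<lbrakk>A \<in> objs C; zero_object C Z\<rbrakk>
    \<Longrightarrow> etriangle C A (ident C A) A (zmor A Z) Z (zext Z A)"
  using split_etri biproduct_zero_right by blast

lemma etri_id_right: "\<lbrakk>A \<in> objs C; zero_object C Z\<rbrakk>
    \<Longrightarrow> etriangle C Z (zmor Z A) A (ident C A) A (zext A Z)"
  using split_etri biproduct_zero_right biproduct_swap by blast

lemma zero_objectE: obtains Z where "zero_object C Z" "Z \<in> objs C"
  using ex_zero_object zero_object_iff by blast

text \<open>
  The following exactness statements are the parts of the long exact sequences of \<open>Hom\<close> and \<open>E\<close>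
  attached to a triangle. All but the last come from comparing it with a split triangle \<open>W = W \<rightarrow> 0\<close> or
  \<open>0 \<rightarrow> W = W\<close>.
\<close>

lemma etri_comp_zero:
  assumes t: "etriangle C A x B y Z d" shows "y \<cdot>\<^bsub>C\<^esub> x = zmor A Z"
proof -
  obtain O' where O: "zero_object C O'" "O' \<in> objs C" by (rule zero_objectE)
  note T = etriD[OF t]
  obtain c where c: "mor c O' Z" "y \<cdot>\<^bsub>C\<^esub> x = c \<cdot>\<^bsub>C\<^esub> zmor A O'"
    using etri_ET3[OF etri_id_left[OF T(1) O(1)] t mor_ident[OF T(1)] T(4)] id_right[OF T(4)] by metis
  then show ?thesis using cmp_zero_right T(1) by simp
qed

lemma etri_push_zero:
  assumes t: "etriangle C A x B y Z d" shows "push C Z x d = zext Z B"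
proof -
  obtain O' where O: "zero_object C O'" "O' \<in> objs C" by (rule zero_objectE)
  note T = etriD[OF t]
  obtain c where c: "mor c Z O'" "push C Z x d = pull C c B (zext O' B)"
    using etri_ET3[OF t etri_id_left[OF T(2) O(1)] T(4) mor_ident[OF T(2)]] by metis
  then show ?thesis using pull_zext T(2) by simp
qed

lemma etri_pull_zero:
  assumes t: "etriangle C A x B y Z d" shows "pull C y A d = zext B A"
proof -
  obtain O' where O: "zero_object C O'" "O' \<in> objs C" by (rule zero_objectE)
  note T = etriD[OF t]
  obtain a where a: "mor a O' A" "push C B a (zext B O') = pull C y A d"
    using etri_ET3_op[OF etri_id_right[OF T(2) O(1)] t mor_ident[OF T(2)] T(5)] by metis
  then show ?thesis using push_zext T(2) by simp
qed

lemma lift_through_inflation: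
  assumes t: "etriangle C A x B y Z d" and f: "mor f W B" "y \<cdot>\<^bsub>C\<^esub> f = zmor W Z"
  obtains g where "mor g W A" "f = x \<cdot>\<^bsub>C\<^esub> g"
proof -
  obtain O' where O: "zero_object C O'" "O' \<in> objs C" by (rule zero_objectE)
  note T = etriD[OF t]
  have W: "W \<in> objs C" using f morD by blast
  have "y \<cdot>\<^bsub>C\<^esub> f = zmor O' Z \<cdot>\<^bsub>C\<^esub> zmor W O'"
    using f cmp_zero_left[OF T(3) mor_zero[OF W O(2)]] by simp
  then obtain a where "mor a W A" "f \<cdot>\<^bsub>C\<^esub> ident C W = x \<cdot>\<^bsub>C\<^esub> a"
    using etri_ET3_op[OF etri_id_left[OF W O(1)] t f(1) mor_zero[OF O(2) T(3)]] by metis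
  then show thesis using that f id_right by simp
qed

lemma factor_through_deflation:
  assumes t: "etriangle C A x B y Z d" and f: "mor f B W" "f \<cdot>\<^bsub>C\<^esub> x = zmor A W"
  obtains g where "mor g Z W" "f = g \<cdot>\<^bsub>C\<^esub> y"
proof -
  obtain O' where O: "zero_object C O'" "O' \<in> objs C" by (rule zero_objectE)
  note T = etriD[OF t]
  have W: "W \<in> objs C" using f morD by blast
  have "f \<cdot>\<^bsub>C\<^esub> x = zmor O' W \<cdot>\<^bsub>C\<^esub> zmor A O'"
    using f cmp_zero_left[OF W mor_zero[OF T(1) O(2)]] by simp
  then obtain c where "mor c Z W" "ident C W \<cdot>\<^bsub>C\<^esub> f = c \<cdot>\<^bsub>C\<^esub> y"
    using etri_ET3[OF t etri_id_right[OF W O(1)] mor_zero[OF T(1) O(2)] f(1)] by metis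
  then show thesis using that f id_left by simp
qed

lemma extend_along_inflation:
  assumes t: "etriangle C A x B y Z d" and a: "mor a A W" "push C Z a d = zext Z W"
  obtains b where "mor b B W" "b \<cdot>\<^bsub>C\<^esub> x = a"
proof -
  obtain O' where O: "zero_object C O'" "O' \<in> objs C" by (rule zero_objectE)
  note T = etriD[OF t]
  have W: "W \<in> objs C" using a morD by blast
  have "push C Z a d = pull C (zmor Z O') W (zext O' W)"
    using a pull_zext[OF mor_zero[OF T(3) O(2)] W] by simp
  then obtain b where "mor b B W" "b \<cdot>\<^bsub>C\<^esub> x = ident C W \<cdot>\<^bsub>C\<^esub> a"
    using etri_morphism[OF t etri_id_left[OF W O(1)] a(1) mor_zero[OF T(3) O(2)]] by metis
  then show thesis using that a id_left by simp
qed

lemma lift_along_deflation: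
  assumes t: "etriangle C A x B y Z d" and c: "mor c W Z" "pull C c A d = zext W A"
  obtains b where "mor b W B" "y \<cdot>\<^bsub>C\<^esub> b = c"
proof -
  obtain O' where O: "zero_object C O'" "O' \<in> objs C" by (rule zero_objectE)
  note T = etriD[OF t]
  have W: "W \<in> objs C" using c morD by blast
  have "push C W (zmor O' A) (zext W O') = pull C c A d"
    using c push_zext[OF mor_zero[OF O(2) T(1)] W] by simp
  then obtain b where "mor b W B" "y \<cdot>\<^bsub>C\<^esub> b = c \<cdot>\<^bsub>C\<^esub> ident C W"
    using etri_morphism[OF etri_id_right[OF W O(1)] t mor_zero[OF O(2) T(1)] c(1)] by metis
  then show thesis using that c id_right by simp
qed

text \<open>
  Exactness of \<open>Hom(W, Z) \<rightarrow> E(W, A) \<rightarrow> E(W, B)\<close>: if \<open>x\<close> kills \<open>e\<close>, then \<open>x\<close> extends over the middle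
  term of a triangle for \<open>e\<close>, and (ET3) completes this to a morphism of triangles.
\<close>

lemma ext_killed_by_inflation:
  assumes t: "etriangle C A x B y Z d" and W: "W \<in> objs C"
    and e: "e \<in> exts C W A" "push C W x e = zext W B"
  obtains c where "mor c W Z" "e = pull C c A d"
proof -
  note T = etriD[OF t]
  obtain n N m where tn: "etriangle C A n N m W e" using etri_realize[OF T(1) W e(1)] .
  obtain g where g: "mor g N B" "g \<cdot>\<^bsub>C\<^esub> n = x" using extend_along_inflation[OF tn T(4) e(2)] .
  then obtain c where "mor c W Z" "push C W (ident C A) e = pull C c A d"
    using etri_ET3[OF tn t mor_ident[OF T(1)] g(1)] id_right[OF T(4)] by metis
  then show thesis using that push_ident[OF T(1) W e(1)] by simp
qed

section \<open>Comparison of triangles, splittings and pushouts\<close>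


text \<open>
  The difference \<open>u - 1\<close> vanishes on \<open>x\<close>, hence factors through \<open>y\<close>; as \<open>y\<close> kills it, its square is
  zero.
\<close>

lemma etri_endo_mid_iso:
  assumes t: "etriangle C A x B y Z d" and u: "mor u B B" "u \<cdot>\<^bsub>C\<^esub> x = x" "y \<cdot>\<^bsub>C\<^esub> u = y"
  shows "isomorphism C B B u"
proof -
  note T = etriD[OF t]
  define n where "n = u \<ominus>\<^bsub>Hom C B B\<^esub> ident C B"
  have n: "mor n B B" unfolding n_def using u T(2) mor_minus mor_ident by blast
  have "n \<cdot>\<^bsub>C\<^esub> x = zmor A B" unfolding n_def
    using minus_left[OF T(4) u(1) mor_ident[OF T(2)]] u(2) id_left[OF T(4)] minus_zero_iff[OF T(4) T(4)] by simp
  then obtain m where m: "mor m Z B" "n = m \<cdot>\<^bsub>C\<^esub> y" using factor_through_deflation[OF t n] by metis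
  have yn: "y \<cdot>\<^bsub>C\<^esub> n = zmor B Z" unfolding n_def
    using minus_right[OF u(1) mor_ident[OF T(2)] T(5)] u(3) id_right[OF T(5)] minus_zero_iff[OF T(5) T(5)] by simp
  have "n \<cdot>\<^bsub>C\<^esub> n = m \<cdot>\<^bsub>C\<^esub> (y \<cdot>\<^bsub>C\<^esub> n)" using mor_assoc[OF n T(5) m(1)] m(2) by simp
  also have "\<dots> = zmor B B" unfolding yn using cmp_zero_right T(2) m(1) by blast
  finally show ?thesis using iso_of_square_zero[OF u(1) n_def] by blast
qed

text \<open>
  Here \<open>u - 1\<close> annihilates \<open>d\<close>, hence extends along \<open>x\<close>; as it is killed by \<open>x\<close>, its square is zero.
\<close>

lemma etri_endo_left_iso:
  assumes t: "etriangle C A x B y Z d" and u: "mor u A A" "x \<cdot>\<^bsub>C\<^esub> u = x" "push C Z u d = d"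
  shows "isomorphism C A A u"
proof -
  note T = etriD[OF t]
  define n where "n = u \<ominus>\<^bsub>Hom C A A\<^esub> ident C A"
  have n: "mor n A A" unfolding n_def using u T(1) mor_minus mor_ident by blast
  have "push C Z n d = zext Z A" unfolding n_def
    using push_diff[OF u(1) mor_ident[OF T(1)] T(3) T(6)] u(3) push_ident[OF T(1,3,6)] by simp
  then obtain v where v: "mor v B A" "v \<cdot>\<^bsub>C\<^esub> x = n" using extend_along_inflation[OF t n] by metis
  have xn: "x \<cdot>\<^bsub>C\<^esub> n = zmor A B" unfolding n_def
    using minus_right[OF u(1) mor_ident[OF T(1)] T(4)] u(2) id_right[OF T(4)] minus_zero_iff[OF T(4) T(4)] by simp
  have "n \<cdot>\<^bsub>C\<^esub> n = v \<cdot>\<^bsub>C\<^esub> (x \<cdot>\<^bsub>C\<^esub> n)" using mor_assoc[OF n T(4) v(1)] v(2) by simp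
  also have "\<dots> = zmor A A" unfolding xn using cmp_zero_right T(1) v(1) by blast
  finally show ?thesis using iso_of_square_zero[OF u(1) n_def] by blast
qed

text \<open>
  Both \<open>(1, c)\<close> and its inverse are realized by morphisms of the middle terms. Their composites need
  not be identities, but are isomorphisms by \<open>etri_endo_mid_iso\<close>.
\<close>

lemma etri_isomorphic_middle:
  assumes t: "etriangle C A x B y Z d" and t': "etriangle C A x' B' y' Z' d'"
    and c: "mor c Z Z'" "mor c' Z' Z" "c' \<cdot>\<^bsub>C\<^esub> c = ident C Z" "c \<cdot>\<^bsub>C\<^esub> c' = ident C Z'"
    and d': "d' = pull C c' A d"
  obtains b where "isomorphism C B B' b" "mor b B B'" "b \<cdot>\<^bsub>C\<^esub> x = x'" "y' \<cdot>\<^bsub>C\<^esub> b = c \<cdot>\<^bsub>C\<^esub> y"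
proof -
  note T = etriD[OF t] and T' = etriD[OF t']
  have "push C Z (ident C A) d = pull C c A d'"
    unfolding d' pull_cmp[OF c(2,1) T(1) T(6), symmetric] c(3) pull_ident[OF T(1,3,6)] push_ident[OF T(1,3,6)] ..
  from etri_morphism[OF t t' mor_ident[OF T(1)] c(1) this]
  obtain b where b: "mor b B B'" "b \<cdot>\<^bsub>C\<^esub> x = x'" "y' \<cdot>\<^bsub>C\<^esub> b = c \<cdot>\<^bsub>C\<^esub> y"
    unfolding id_right[OF T'(4)] .
  have "push C Z' (ident C A) d' = pull C c' A d" unfolding push_ident[OF T(1) T'(3,6)] by (rule d')
  from etri_morphism[OF t' t mor_ident[OF T(1)] c(2) this]
  obtain b' where b': "mor b' B' B" "b' \<cdot>\<^bsub>C\<^esub> x' = x" "y \<cdot>\<^bsub>C\<^esub> b' = c' \<cdot>\<^bsub>C\<^esub> y'"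
    unfolding id_right[OF T(4)] .
  let ?u = "b' \<cdot>\<^bsub>C\<^esub> b" and ?v = "b \<cdot>\<^bsub>C\<^esub> b'"
  have mu: "mor ?u B B" and mv: "mor ?v B' B'" using b b' mor_cmp by blast+
  have ux: "?u \<cdot>\<^bsub>C\<^esub> x = x" using mor_assoc[OF T(4) b(1) b'(1)] b b' by simp
  have yu: "y \<cdot>\<^bsub>C\<^esub> ?u = y"
    using mor_assoc[OF b(1) b'(1) T(5)] mor_assoc[OF b(1) T'(5) c(2)] mor_assoc[OF T(5) c(1,2)] b b' c id_left[OF T(5)]
    by simp
  have vx: "?v \<cdot>\<^bsub>C\<^esub> x' = x'" using mor_assoc[OF T'(4) b'(1) b(1)] b b' by simp
  have yv: "y' \<cdot>\<^bsub>C\<^esub> ?v = y'"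
    using mor_assoc[OF b'(1) b(1) T'(5)] mor_assoc[OF b'(1) T(5) c(1)] mor_assoc[OF T'(5) c(2,1)] b b' c id_left[OF T'(5)]
    by simp
  have iu: "isomorphism C B B ?u" by (rule etri_endo_mid_iso[OF t mu ux yu])
  have iv: "isomorphism C B' B' ?v" by (rule etri_endo_mid_iso[OF t' mv vx yv])
  have "isomorphism C B B' b" by (rule iso_of_iso_comps[OF b(1) b'(1) iu iv])
  then show thesis using that b by blast
qed

lemma seq_equiv_trans:
  assumes "seq_equiv C A Z s t" "seq_equiv C A Z t u" "A \<in> objs C" "Z \<in> objs C"
  shows "seq_equiv C A Z s u"
proof -
  obtain x y x' y' x'' y'' where eq: "s = (x, y)" "t = (x', y')" "u = (x'', y'')" by (metis surj_pair)
  obtain B B' b where b: "B \<in> objs C" "B' \<in> objs C" "x \<in> arr C A B" "y \<in> arr C B Z" "x' \<in> arr C A B'"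
    "y' \<in> arr C B' Z" "isomorphism C B B' b" "b \<cdot>\<^bsub>C\<^esub> x = x'" "y' \<cdot>\<^bsub>C\<^esub> b = y"
    using assms(1) eq unfolding seq_equiv_def by auto
  obtain D D' c where c: "D \<in> objs C" "D' \<in> objs C" "x' \<in> arr C A D" "y' \<in> arr C D Z" "x'' \<in> arr C A D'"
    "y'' \<in> arr C D' Z" "isomorphism C D D' c" "c \<cdot>\<^bsub>C\<^esub> x' = x''" "y'' \<cdot>\<^bsub>C\<^esub> c = y'"
    using assms(2) eq unfolding seq_equiv_def by auto
  have D: "D = B'" using hom_disjoint[OF assms(3) b(2) assms(3) c(1) b(5) c(3)] by simp
  have Z: "mor y'' D' Z" if "Z \<in> objs C" using c that by (simp add: mor_def)
  have mb: "mor b B B'" using b by (simp add: mor_def isomorphism_def)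
  have mc: "mor c B' D'" using c D b by (simp add: mor_def isomorphism_def)
  have mx: "mor x A B" using b assms(3) by (simp add: mor_def)
  have i: "isomorphism C B D' (c \<cdot>\<^bsub>C\<^esub> b)" using iso_cmp[OF b(7)] c D b by simp
  have 1: "(c \<cdot>\<^bsub>C\<^esub> b) \<cdot>\<^bsub>C\<^esub> x = x''" using mor_assoc[OF mx mb mc] b(8) c(8) by simp
  have "y'' \<cdot>\<^bsub>C\<^esub> (c \<cdot>\<^bsub>C\<^esub> b) = y" using mor_assoc[OF mb mc Z[OF assms(4)]] b(9) c(9) by simp
  then show ?thesis unfolding eq seq_equiv_def using b(1,3,4) c(2,5,6) i 1 by blast
qed

lemma etri_mid_iso:
  assumes t: "etriangle C A x B y Z d" and b: "mor b B B'" "mor b' B' B"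
    and i: "b' \<cdot>\<^bsub>C\<^esub> b = ident C B" "b \<cdot>\<^bsub>C\<^esub> b' = ident C B'"
  shows "etriangle C A (b \<cdot>\<^bsub>C\<^esub> x) B' (y \<cdot>\<^bsub>C\<^esub> b') Z d"
proof -
  note T = etriD[OF t]
  from rlz_class[OF T(1,3,6)] obtain x0 y0 where r: "rlz C Z A d = {s. seq_equiv C A Z (x0, y0) s}"
    by metis
  have 1: "seq_equiv C A Z (x0, y0) (x, y)" using t r by (auto simp: etriangle_def)
  have mx: "mor (b \<cdot>\<^bsub>C\<^esub> x) A B'" using mor_cmp T(4) b(1) .
  have my: "mor (y \<cdot>\<^bsub>C\<^esub> b') B' Z" using mor_cmp b(2) T(5) .
  have "(y \<cdot>\<^bsub>C\<^esub> b') \<cdot>\<^bsub>C\<^esub> b = y" using mor_assoc[OF b(1,2) T(5)] i id_right[OF T(5)] by simp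
  then have "seq_equiv C A Z (x, y) (b \<cdot>\<^bsub>C\<^esub> x, y \<cdot>\<^bsub>C\<^esub> b')"
    unfolding seq_equiv_def using isoI[OF b i] morD[OF T(4)] morD[OF T(5)] morD[OF mx] morD[OF my] by blast
  then have "seq_equiv C A Z (x0, y0) (b \<cdot>\<^bsub>C\<^esub> x, y \<cdot>\<^bsub>C\<^esub> b')" using seq_equiv_trans 1 T(1) T(3) by blast
  then show ?thesis using r T morD[OF mx] morD[OF my] by (simp add: etriangle_def)
qed

lemma etri_right_iso:
  assumes t: "etriangle C A x B y Z d" and c: "mor c Z Z'" "mor c' Z' Z"
    and i: "c' \<cdot>\<^bsub>C\<^esub> c = ident C Z" "c \<cdot>\<^bsub>C\<^esub> c' = ident C Z'"
  shows "etriangle C A x B (c \<cdot>\<^bsub>C\<^esub> y) Z' (pull C c' A d)"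
proof -
  note T = etriD[OF t]
  have "pull C c' A d \<in> exts C Z' A" by (rule pull_closed[OF c(2) T(1,6)])
  from etri_realize[OF T(1) morD(2)[OF c(1)] this]
  obtain x0 B0 y0 where t0: "etriangle C A x0 B0 y0 Z' (pull C c' A d)" .
  note T0 = etriD[OF t0]
  from etri_isomorphic_middle[OF t t0 c i refl]
  obtain b where b: "isomorphism C B B0 b" "mor b B B0" "b \<cdot>\<^bsub>C\<^esub> x = x0" "y0 \<cdot>\<^bsub>C\<^esub> b = c \<cdot>\<^bsub>C\<^esub> y" .
  from isoE[OF b(1) T(2) T0(2)]
  obtain b' where b': "mor b' B0 B" "b' \<cdot>\<^bsub>C\<^esub> b = ident C B" "b \<cdot>\<^bsub>C\<^esub> b' = ident C B0" by metis
  have "b' \<cdot>\<^bsub>C\<^esub> x0 = x" using mor_assoc[OF T(4) b(2) b'(1)] b'(2) b(3) id_left[OF T(4)] by simp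
  then show ?thesis using etri_mid_iso[OF t0 b'(1) b(2) b'(3,2)] b(4) by simp
qed

lemma etri_mid_unique:
  assumes t: "etriangle C A x B y Z d" and t': "etriangle C A x' B' y' Z d"
  shows "isomorphic C B B'"
proof -
  note T = etriD[OF t]
  have I: "mor (ident C Z) Z Z" using T mor_ident by blast
  have "d = pull C (ident C Z) A d" using pull_ident[OF T(1,3,6)] by simp
  from etri_isomorphic_middle[OF t t' I I id_left[OF I] id_left[OF I] this]
  show ?thesis unfolding isomorphic_def by blast
qed

text \<open>
  Compare the two triangles by (ET3)\<open>\<^sup>o\<^sup>p\<close> in both directions; \<open>etri_endo_left_iso\<close> shows that the
  composites are isomorphisms.
\<close>

lemma cocone_unique:
  assumes t: "etriangle C A x B y Z d" and t': "etriangle C A' x' B y Z d'"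
  shows "isomorphic C A A'"
proof -
  note T = etriD[OF t] and T' = etriD[OF t']
  have yy: "y \<cdot>\<^bsub>C\<^esub> ident C B = ident C Z \<cdot>\<^bsub>C\<^esub> y" using id_right[OF T(5)] id_left[OF T(5)] by simp
  from etri_ET3_op[OF t t' mor_ident[OF T(2)] mor_ident[OF T(3)] yy] obtain a
    where a: "mor a A A'" "x = x' \<cdot>\<^bsub>C\<^esub> a" "push C Z a d = d'"
    unfolding id_left[OF T(4)] pull_ident[OF T'(1,3,6)] .
  from etri_ET3_op[OF t' t mor_ident[OF T(2)] mor_ident[OF T(3)] yy] obtain a'
    where a': "mor a' A' A" "x' = x \<cdot>\<^bsub>C\<^esub> a'" "push C Z a' d' = d"
    unfolding id_left[OF T'(4)] pull_ident[OF T(1,3,6)] .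
  have "isomorphism C A A (a' \<cdot>\<^bsub>C\<^esub> a)"
  proof (rule etri_endo_left_iso[OF t mor_cmp[OF a(1) a'(1)]])
    show "x \<cdot>\<^bsub>C\<^esub> (a' \<cdot>\<^bsub>C\<^esub> a) = x" unfolding mor_assoc[OF a(1) a'(1) T(4), symmetric] a'(2)[symmetric] a(2)[symmetric] ..
    show "push C Z (a' \<cdot>\<^bsub>C\<^esub> a) d = d" unfolding push_cmp[OF a(1) a'(1) T(3,6)] a(3) a'(3) ..
  qed
  moreover have "isomorphism C A' A' (a \<cdot>\<^bsub>C\<^esub> a')"
  proof (rule etri_endo_left_iso[OF t' mor_cmp[OF a'(1) a(1)]])
    show "x' \<cdot>\<^bsub>C\<^esub> (a \<cdot>\<^bsub>C\<^esub> a') = x'" unfolding mor_assoc[OF a'(1) a(1) T'(4), symmetric] a(2)[symmetric] a'(2)[symmetric] ..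
    show "push C Z (a \<cdot>\<^bsub>C\<^esub> a') d' = d'" unfolding push_cmp[OF a'(1) a(1) T'(3,6)] a'(3) a(3) ..
  qed
  ultimately show ?thesis using iso_of_iso_comps[OF a(1) a'(1)] unfolding isomorphic_def by blast
qed

text \<open>
  A retraction of \<open>x\<close> forces \<open>d = 0\<close>, so \<open>y\<close> has a section; subtracting its component along \<open>x\<close> makes
  it complementary to \<open>r\<close>.
\<close>

lemma split_of_retraction:
  assumes t: "etriangle C A x B y Z d" and r: "mor r B A" "r \<cdot>\<^bsub>C\<^esub> x = ident C A"
  obtains s where "biproduct C A Z B x s r y"
proof -
  note T = etriD[OF t]
  have "d = push C Z r (push C Z x d)"
    using push_cmp[OF T(4) r(1) T(3,6)] r(2) push_ident[OF T(1,3,6)] by simp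
  then have d0: "d = zext Z A" using etri_push_zero[OF t] push_zext[OF r(1) T(3)] by simp
  have "pull C (ident C Z) A d = zext Z A" using pull_ident[OF T(1,3,6)] d0 by simp
  from lift_along_deflation[OF t mor_ident[OF T(3)] this]
  obtain s where s: "mor s Z B" "y \<cdot>\<^bsub>C\<^esub> s = ident C Z" .
  have mrs: "mor (r \<cdot>\<^bsub>C\<^esub> s) Z A" by (rule mor_cmp[OF s(1) r(1)])
  have mxrs: "mor (x \<cdot>\<^bsub>C\<^esub> (r \<cdot>\<^bsub>C\<^esub> s)) Z B" by (rule mor_cmp[OF mrs T(4)])
  define s' where "s' = s \<ominus>\<^bsub>Hom C Z B\<^esub> (x \<cdot>\<^bsub>C\<^esub> (r \<cdot>\<^bsub>C\<^esub> s))"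
  have ms': "mor s' Z B" unfolding s'_def by (rule mor_minus[OF s(1) mxrs])
  have "r \<cdot>\<^bsub>C\<^esub> (x \<cdot>\<^bsub>C\<^esub> (r \<cdot>\<^bsub>C\<^esub> s)) = r \<cdot>\<^bsub>C\<^esub> s"
    using mor_assoc[OF mrs T(4) r(1)] r(2) id_left[OF mrs] by simp
  then have rs': "r \<cdot>\<^bsub>C\<^esub> s' = zmor Z A" unfolding s'_def minus_right[OF s(1) mxrs r(1)]
    using minus_zero_iff[OF mrs mrs] by simp
  have "y \<cdot>\<^bsub>C\<^esub> (x \<cdot>\<^bsub>C\<^esub> (r \<cdot>\<^bsub>C\<^esub> s)) = zmor Z Z"
    using mor_assoc[OF mrs T(4,5)] etri_comp_zero[OF t] cmp_zero_left[OF T(3) mrs] by simp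
  then have ys': "y \<cdot>\<^bsub>C\<^esub> s' = ident C Z" unfolding s'_def minus_right[OF s(1) mxrs T(5)] s(2)
    using minus_of_zero[OF mor_ident[OF T(3)]] by simp
  \<comment> \<open>\<open>1 - x \<cdot> r\<close> vanishes on \<open>x\<close>, hence is \<open>v \<cdot> y\<close>; evaluating at \<open>s'\<close> gives \<open>v = s'\<close>\<close>
  have mxr: "mor (x \<cdot>\<^bsub>C\<^esub> r) B B" by (rule mor_cmp[OF r(1) T(4)])
  define w where "w = ident C B \<ominus>\<^bsub>Hom C B B\<^esub> (x \<cdot>\<^bsub>C\<^esub> r)"
  have mw: "mor w B B" unfolding w_def by (rule mor_minus[OF mor_ident[OF T(2)] mxr])
  have "w \<cdot>\<^bsub>C\<^esub> x = zmor A B" unfolding w_def minus_left[OF T(4) mor_ident[OF T(2)] mxr]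
    using mor_assoc[OF T(4) r(1) T(4)] r(2) id_left[OF T(4)] id_right[OF T(4)] minus_zero_iff[OF T(4) T(4)] by simp
  from factor_through_deflation[OF t mw this] obtain v where v: "mor v Z B" "w = v \<cdot>\<^bsub>C\<^esub> y" .
  have "w \<cdot>\<^bsub>C\<^esub> s' = s'" unfolding w_def minus_left[OF ms' mor_ident[OF T(2)] mxr]
    using mor_assoc[OF ms' r(1) T(4)] rs' cmp_zero_right[OF T(3) T(4)] id_left[OF ms'] minus_of_zero[OF ms'] by simp
  then have "v = s'" using mor_assoc[OF ms' T(5) v(1)] v(2) ys' id_right[OF v(1)] by simp
  then have "(s' \<cdot>\<^bsub>C\<^esub> y) \<oplus>\<^bsub>Hom C B B\<^esub> (x \<cdot>\<^bsub>C\<^esub> r) = ident C B"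
    using minus_plus[OF mor_ident[OF T(2)] mxr] v(2) w_def by simp
  then have "(x \<cdot>\<^bsub>C\<^esub> r) \<oplus>\<^bsub>Hom C B B\<^esub> (s' \<cdot>\<^bsub>C\<^esub> y) = ident C B"
    using abelian_monoid.a_comm[OF abelian_group.axioms(1)[OF hom_group[OF T(2,2)]]
        morD(3)[OF mxr] morD(3)[OF mor_cmp[OF T(5) ms']]] by simp
  then have "biproduct C A Z B x s' r y"
    unfolding biproduct_def using T r rs' ys' etri_comp_zero[OF t] morD(3)[OF T(4)] morD(3)[OF T(5)]
      morD(3)[OF ms'] morD(3)[OF r(1)] by simp
  then show thesis by (rule that)
qed

lemma split_of_section:
  assumes t: "etriangle C A x B y Z d" and s: "mor s Z B" "y \<cdot>\<^bsub>C\<^esub> s = ident C Z"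
  obtains s' r where "biproduct C A Z B x s' r y"
proof -
  note T = etriD[OF t]
  have "d = pull C s A (pull C y A d)"
    using pull_cmp[OF T(5) s(1) T(1,6)] s(2) pull_ident[OF T(1,3,6)] by simp
  then have d0: "d = zext Z A" using etri_pull_zero[OF t] pull_zext[OF s(1) T(1)] by simp
  have "push C Z (ident C A) d = zext Z A" using push_ident[OF T(1,3,6)] d0 by simp
  from extend_along_inflation[OF t mor_ident[OF T(1)] this]
  obtain r where r: "mor r B A" "r \<cdot>\<^bsub>C\<^esub> x = ident C A" .
  from split_of_retraction[OF t r] that show thesis by blast
qed

text \<open>
  A pushout of two inflations with the same source. The extension \<open>d1 \<oplus> d2\<close>, pushed forward along the
  codiagonal of \<open>A\<close>, is an extension of \<open>Z1 \<oplus> Z2\<close> by \<open>A\<close>, whose middle term \<open>N\<close> is the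
  pushout. Composing \<open>N \<rightarrow> Z1 \<oplus> Z2\<close> with the two projections yields the two conflations by
  (ET4)\<open>\<^sup>o\<^sup>p\<close>: their cocones realize the restrictions \<open>d2\<close> and \<open>d1\<close>.
\<close>

lemma common_inflation_pushout:
  assumes t1: "etriangle C A x1 B1 y1 Z1 d1" and t2: "etriangle C A x2 B2 y2 Z2 d2"
  obtains E1 E2 N n1 n2 m1 m2 where "conflation C E2 n2 N m1 Z1" "conflation C E1 n1 N m2 Z2"
    "isomorphic C B1 E1" "isomorphic C B2 E2"
proof -
  note T1 = etriD[OF t1] and T2 = etriD[OF t2]
  obtain S i i' r r' where S: "biproduct C Z1 Z2 S i i' r r'" using ex_biproduct T1(3) T2(3) by metis
  note B = biproductD[OF S]
  interpret E: abelian_group "EE C S A" by (rule ext_group[OF T1(1) B(9)])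
  interpret E1: abelian_group "EE C Z1 A" by (rule ext_group[OF T1(1,3)])
  interpret E2: abelian_group "EE C Z2 A" by (rule ext_group[OF T1(1) T2(3)])
  have p1: "pull C r A d1 \<in> exts C S A" and p2: "pull C r' A d2 \<in> exts C S A"
    using pull_closed B(3,4) T1 T2 by blast+
  define \<nu> where "\<nu> = pull C r A d1 \<oplus>\<^bsub>EE C S A\<^esub> pull C r' A d2"
  have nu: "\<nu> \<in> exts C S A" unfolding \<nu>_def using p1 p2 by simp
  have "pull C i A (pull C r A d1) = d1"
    using pull_cmp[OF B(3,1) T1(1,6)] B(5) pull_ident[OF T1(1,3,6)] by simp
  moreover have "pull C i A (pull C r' A d2) = zext Z1 A"
    using pull_cmp[OF B(4,1) T2(1,6)] B(8) pull_zmor[OF T2(1) T1(3) T2(3) T2(6)] by simp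
  ultimately have nu1: "pull C i A \<nu> = d1"
    unfolding \<nu>_def pull_plus[OF B(1) T1(1) p1 p2] using T1(6) by simp
  have "pull C i' A (pull C r A d1) = zext Z2 A"
    using pull_cmp[OF B(3,2) T1(1,6)] B(7) pull_zmor[OF T1(1) T2(3) T1(3) T1(6)] by simp
  moreover have "pull C i' A (pull C r' A d2) = d2"
    using pull_cmp[OF B(4,2) T2(1,6)] B(6) pull_ident[OF T2(1,3,6)] by simp
  ultimately have nu2: "pull C i' A \<nu> = d2"
    unfolding \<nu>_def pull_plus[OF B(2) T1(1) p1 p2] using T2(6) by simp
  from etri_realize[OF T1(1) B(9) nu] obtain n N q where tN: "etriangle C A n N q S \<nu>" .
  from etri_ET4_op[OF split_etri[OF biproduct_swap[OF S]] tN] obtain E2 h2 e2 c2 g2 where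
    2: "etriangle C E2 h2 N (r \<cdot>\<^bsub>C\<^esub> q) Z1 g2" "etriangle C A e2 E2 c2 Z2 d2" unfolding nu2 by metis
  from etri_ET4_op[OF split_etri[OF S] tN] obtain E1 h1 e1 c1 g1 where
    1: "etriangle C E1 h1 N (r' \<cdot>\<^bsub>C\<^esub> q) Z2 g1" "etriangle C A e1 E1 c1 Z1 d1" unfolding nu1 by metis
  show thesis
    using that[of E2 h2 N "r \<cdot>\<^bsub>C\<^esub> q" E1 h1 "r' \<cdot>\<^bsub>C\<^esub> q"] 1(1) 2(1) etri_mid_unique[OF t1 1(2)] etri_mid_unique[OF t2 2(2)]
    unfolding conflation_def by blast
qed

section \<open>Extensions into injective and orthogonal objects\<close>


lemma perp1I: "\<lbrakk>M \<in> objs C; \<And>U e. \<lbrakk>U \<in> \<U>; e \<in> exts C U M\<rbrakk> \<Longrightarrow> e = zext U M; \<U> \<subseteq> objs C\<rbrakk> \<Longrightarrow> M \<in> perp1 C \<U>"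
  unfolding perp1_def using zext_closed by blast

lemma perp1D: "\<lbrakk>M \<in> perp1 C \<U>; U \<in> \<U>; e \<in> exts C U M\<rbrakk> \<Longrightarrow> e = zext U M"
  by (auto simp: perp1_def)

lemma perp1_retract:
  assumes U: "\<U> \<subseteq> objs C" and N: "N \<in> perp1 C \<U>" and r: "mor i M N" "mor p N M" "p \<cdot>\<^bsub>C\<^esub> i = ident C M"
  shows "M \<in> perp1 C \<U>"
proof (rule perp1I[OF morD(1)[OF r(1)] _ U])
  fix W e assume W: "W \<in> \<U>" and e: "e \<in> exts C W M"
  have o: "W \<in> objs C" using U W by blast
  have "e = push C W p (push C W i e)"
    using push_cmp[OF r(1,2) o e] r(3) push_ident[OF morD(1)[OF r(1)] o e] by simp
  also have "push C W i e = zext W N" using perp1D[OF N W push_closed[OF r(1) o e]] .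
  also have "push C W p (zext W N) = zext W M" by (rule push_zext[OF r(2) o])
  finally show "e = zext W M" .
qed

lemma perp1_iso:
  assumes "\<U> \<subseteq> objs C" "N \<in> perp1 C \<U>" "isomorphic C N M" "M \<in> objs C"
  shows "M \<in> perp1 C \<U>"
proof -
  have N: "N \<in> objs C" using assms(2) by (simp add: perp1_def)
  obtain f where "isomorphism C N M f" using assms(3) by (auto simp: isomorphic_def)
  from isoE[OF this N assms(4)] show ?thesis using perp1_retract[OF assms(1,2)] by metis
qed

text \<open>
  The identity of \<open>I\<close> extends along the inflation realizing \<open>e\<close>, which therefore splits.
\<close>

lemma ext_into_injective:
  assumes I: "is_injective C I" and W: "W \<in> objs C" and e: "e \<in> exts C W I"
  shows "e = zext W I"
proof -
  have o: "I \<in> objs C" using I by (simp add: is_injective_def)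
  from etri_realize[OF o W e] obtain x B y where t: "etriangle C I x B y W e" .
  note T = etriD[OF t]
  have "\<exists>g\<in>arr C B I. ident C I = g \<cdot>\<^bsub>C\<^esub> x"
    using I t ident_closed[OF o] unfolding is_injective_def conflation_def by blast
  then obtain g where g: "mor g B I" "g \<cdot>\<^bsub>C\<^esub> x = ident C I" using T by (auto simp: mor_def)
  have "e = push C W g (push C W x e)" using push_cmp[OF T(4) g(1) W e] g(2) push_ident[OF o W e] by simp
  then show ?thesis unfolding etri_push_zero[OF t] push_zext[OF g(1) W] .
qed

end


section \<open>Filtrations\<close>


definition extension_closed :: "('o, 'm, 'k, 'e, 'z) extri_cat_scheme \<Rightarrow> 'o set \<Rightarrow> bool" where
  "extension_closed C D \<longleftrightarrow> (\<forall>A x B y Z d. etriangle C A x B y Z d \<and> A \<in> D \<and> Z \<in> D \<longrightarrow> B \<in> D)"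

context extriangulated_category
begin


lemma ext_zero_right:
  assumes "zero_object C Z" "A \<in> objs C" "d \<in> exts C Z A" shows "d = zext Z A"
proof -
  have Z: "Z \<in> objs C" "ident C Z = zmor Z Z" using assms zero_object_iff by auto
  show ?thesis using pull_ident[OF assms(2) Z(1) assms(3)] pull_zmor[OF assms(2) Z(1) Z(1) assms(3)] Z(2) by simp
qed

lemma zero_object_iso:
  assumes "zero_object C Z" "isomorphic C Z Z'" "Z' \<in> objs C" shows "zero_object C Z'"
proof -
  have Z: "Z \<in> objs C" using assms(1) zero_object_iff by simp
  obtain f where "isomorphism C Z Z' f" using assms(2) isomorphic_def by metis
  then obtain g where g: "mor f Z Z'" "mor g Z' Z" "f \<cdot>\<^bsub>C\<^esub> g = ident C Z'" using isoE[OF _ Z assms(3)] by metis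
  have "f = zmor Z Z'" using zero_object_from[OF assms(1) g(1)] .
  then show ?thesis using g(3) cmp_zero_left[OF assms(3) g(2)] assms(3) zero_object_iff by simp
qed

lemma inflation_onto_zero_iso:
  assumes t: "etriangle C A x B y Z d" and z: "zero_object C Z"
  shows "isomorphism C A B x"
proof -
  note T = etriD[OF t]
  have "push C Z (ident C A) d = zext Z A" using push_ident[OF T(1,3,6)] ext_zero_right[OF z T(1,6)] by simp
  from extend_along_inflation[OF t mor_ident[OF T(1)] this]
  obtain r where r: "mor r B A" "r \<cdot>\<^bsub>C\<^esub> x = ident C A" .
  have "y \<cdot>\<^bsub>C\<^esub> ident C B = zmor B Z" using zero_object_to[OF z T(5)] id_right[OF T(5)] by simp
  from lift_through_inflation[OF t mor_ident[OF T(2)] this]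
  obtain a where a: "mor a B A" "ident C B = x \<cdot>\<^bsub>C\<^esub> a" .
  have "r = a" using mor_assoc[OF a(1) T(4) r(1)] r(2) a(2) id_right[OF r(1)] id_left[OF a(1)] by simp
  then show ?thesis using isoI[OF T(4) r(1) r(2)] a(2) by simp
qed

text \<open>
  Filtrations with a prescribed number of steps, for inductions that remove the top factor.
\<close>

primrec filtered :: "'o set \<Rightarrow> nat \<Rightarrow> 'o \<Rightarrow> bool" where
  "filtered \<Y> 0 M \<longleftrightarrow> zero_object C M"
| "filtered \<Y> (Suc n) M \<longleftrightarrow> (\<exists>M' x y Z d. filtered \<Y> n M' \<and> Z \<in> \<Y> \<and> etriangle C M' x M y Z d)"

lemma filtered_SucI: "\<lbrakk>filtered \<Y> n M'; Z \<in> \<Y>; etriangle C M' x M y Z d\<rbrakk> \<Longrightarrow> filtered \<Y> (Suc n) M"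
  unfolding filtered.simps by blast

lemma filtered_objs: "filtered \<Y> n M \<Longrightarrow> M \<in> objs C"
  by (cases n) (auto simp: zero_object_iff dest: etriD)

lemma filtered_mono: "\<lbrakk>filtered \<Y> n M; \<Y> \<subseteq> \<Y>'\<rbrakk> \<Longrightarrow> filtered \<Y>' n M"
  by (induction n arbitrary: M) (auto, blast)

lemma Filt_iff: "M \<in> Filt C \<Y> \<longleftrightarrow> (\<exists>n. filtered \<Y> n M)"
proof
  assume "M \<in> Filt C \<Y>"
  then obtain n X f where X: "zero_object C (X 0)" "X (n::nat) = M"
    "\<And>i. i < n \<Longrightarrow> \<exists>Z\<in>\<Y>. \<exists>y. conflation C (X i) (f i) (X (Suc i)) y Z"
    unfolding Filt_def by auto
  have "i \<le> n \<Longrightarrow> filtered \<Y> i (X i)" for i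
  proof (induction i)
    case (Suc i)
    then have "filtered \<Y> i (X i)" by simp
    moreover obtain Z y d where "Z \<in> \<Y>" "etriangle C (X i) (f i) (X (Suc i)) y Z d"
      using X(3)[of i] Suc.prems unfolding conflation_def by auto
    ultimately show ?case by (rule filtered_SucI)
  qed (use X in simp)
  then show "\<exists>n. filtered \<Y> n M" using X(2) by blast
next
  have "filtered \<Y> n M \<Longrightarrow> \<exists>X f. zero_object C (X 0) \<and> X n = M \<and>
     (\<forall>i<n. \<exists>Z\<in>\<Y>. \<exists>y. conflation C (X i) (f i) (X (Suc i)) y Z)" for n
  proof (induction n arbitrary: M)
    case 0
    show ?case by (rule exI[of _ "\<lambda>_. M"]) (use 0 in simp)
  next
    case (Suc n)
    then obtain M' x y Z d where M: "filtered \<Y> n M'" "Z \<in> \<Y>" "etriangle C M' x M y Z d" by auto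
    obtain X f where X: "zero_object C (X 0)" "X n = M'"
     "\<forall>i<n. \<exists>Z\<in>\<Y>. \<exists>y. conflation C (X i) (f i) (X (Suc i)) y Z" using Suc.IH[OF M(1)] by blast
    show ?case
      by (rule exI[of _ "X(Suc n := M)"], rule exI[of _ "f(n := x)"])
        (use X M in \<open>auto simp: less_Suc_eq conflation_def\<close>)
  qed
  moreover assume "\<exists>n. filtered \<Y> n M"
  ultimately show "M \<in> Filt C \<Y>" unfolding Filt_def by blast
qed

lemma Filt_extend: "\<lbrakk>A \<in> Filt C \<Y>; Z \<in> \<Y>; etriangle C A x M y Z d\<rbrakk> \<Longrightarrow> M \<in> Filt C \<Y>"
  unfolding Filt_iff by (meson filtered_SucI)

lemma filtered_iso:
  assumes "filtered \<Y> n M" "isomorphic C M M'" "M' \<in> objs C" shows "filtered \<Y> n M'"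
proof (cases n)
  case 0
  then show ?thesis using assms zero_object_iso by auto
next
  case (Suc k)
  obtain N x y Z d where M: "filtered \<Y> k N" "Z \<in> \<Y>" "etriangle C N x M y Z d" using assms(1) Suc by auto
  obtain f where "isomorphism C M M' f" using assms(2) isomorphic_def by metis
  then obtain g where g: "mor f M M'" "mor g M' M" "g \<cdot>\<^bsub>C\<^esub> f = ident C M" "f \<cdot>\<^bsub>C\<^esub> g = ident C M'"
    using isoE[OF _ filtered_objs[OF assms(1)] assms(3)] by metis
  show ?thesis unfolding Suc by (rule filtered_SucI[OF M(1,2) etri_mid_iso[OF M(3) g]])
qed

text \<open>
  If \<open>Z'\<close> is the penultimate term of the filtration of \<open>Z\<close>, the cocone of the composite of \<open>B \<rightarrow> Z\<close> with the
  last deflation of \<open>Z\<close> is an extension of \<open>Z'\<close> by \<open>A\<close>.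
\<close>

lemma filtered_extension:
  assumes "filtered \<Y> m A" "filtered \<Y> n Z" "etriangle C A x B y Z d"
  shows "filtered \<Y> (m + n) B"
  using assms(2,3)
proof (induction n arbitrary: Z B x y d)
  case 0
  then have "isomorphism C A B x" using inflation_onto_zero_iso by simp
  then show ?case using filtered_iso[OF assms(1)] etriD(2)[OF 0(2)] isomorphic_def[of C A B] by auto
next
  case (Suc n)
  obtain Z' z q W e where Z: "filtered \<Y> n Z'" "W \<in> \<Y>" "etriangle C Z' z Z q W e" using Suc.prems by auto
  from etri_ET4_op[OF Z(3) Suc.prems(2)]
  obtain F h' d' e' d3 where F: "etriangle C F h' B (q \<cdot>\<^bsub>C\<^esub> y) W d3"
    "etriangle C A e' F d' Z' (pull C z A d)" by metis
  show ?case unfolding add_Suc_right by (rule filtered_SucI[OF Suc.IH[OF Z(1) F(2)] Z(2) F(1)])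
qed

lemma extension_closed_Filt: "extension_closed C (Filt C \<Y>)"
  unfolding extension_closed_def Filt_iff using filtered_extension by blast

lemma subcategory_Filt: "subcategory C (Filt C \<Y>)"
  unfolding subcategory_def using Filt_iff filtered_iso filtered_objs by blast

lemma zero_in_Filt: "zero_object C Z \<Longrightarrow> Z \<in> Filt C \<Y>"
  using Filt_iff filtered.simps(1) by blast

lemma Filt_mono: "\<Y> \<subseteq> \<Y>' \<Longrightarrow> Filt C \<Y> \<subseteq> Filt C \<Y>'"
  using Filt_iff filtered_mono by blast

lemma generators_in_Filt: "\<lbrakk>Y \<in> \<Y>; Y \<in> objs C\<rbrakk> \<Longrightarrow> Y \<in> Filt C \<Y>"
proof -
  assume Y: "Y \<in> \<Y>" "Y \<in> objs C"
  obtain O' where O: "zero_object C O'" by (rule zero_objectE)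
  have "filtered \<Y> (Suc 0) Y" by (rule filtered_SucI[OF _ Y(1) etri_id_right[OF Y(2) O]]) (simp add: O)
  then show ?thesis using Filt_iff by blast
qed

lemma hom_into_filtered_zero:
  assumes "\<And>Z g. \<lbrakk>Z \<in> \<Y>; mor g W Z\<rbrakk> \<Longrightarrow> g = zmor W Z"
  shows "\<lbrakk>filtered \<Y> n M; mor f W M\<rbrakk> \<Longrightarrow> f = zmor W M"
proof (induction n arbitrary: M f)
  case 0
  then show ?case using zero_object_to by simp
next
  case (Suc n)
  obtain M' x y Z d where M: "filtered \<Y> n M'" "Z \<in> \<Y>" "etriangle C M' x M y Z d" using Suc.prems by auto
  note T = etriD[OF M(3)]
  have "y \<cdot>\<^bsub>C\<^esub> f = zmor W Z" by (rule assms[OF M(2) mor_cmp[OF Suc.prems(2) T(5)]])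
  from lift_through_inflation[OF M(3) Suc.prems(2) this] obtain g where g: "mor g W M'" "f = x \<cdot>\<^bsub>C\<^esub> g" .
  then show ?case using Suc.IH[OF M(1) g(1)] cmp_zero_right[OF morD(1)[OF g(1)] T(4)] by simp
qed

lemma hom_from_filtered_zero:
  assumes "\<And>Z g. \<lbrakk>Z \<in> \<Y>; mor g Z W\<rbrakk> \<Longrightarrow> g = zmor Z W"
  shows "\<lbrakk>filtered \<Y> n M; mor f M W\<rbrakk> \<Longrightarrow> f = zmor M W"
proof (induction n arbitrary: M f)
  case 0
  then show ?case using zero_object_from by simp
next
  case (Suc n)
  obtain M' x y Z d where M: "filtered \<Y> n M'" "Z \<in> \<Y>" "etriangle C M' x M y Z d" using Suc.prems by auto
  note T = etriD[OF M(3)]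
  have "f \<cdot>\<^bsub>C\<^esub> x = zmor M' W" by (rule Suc.IH[OF M(1) mor_cmp[OF T(4) Suc.prems(2)]])
  from factor_through_deflation[OF M(3) Suc.prems(2) this] obtain g where g: "mor g Z W" "f = g \<cdot>\<^bsub>C\<^esub> y" .
  then show ?case using assms[OF M(2) g(1)] cmp_zero_left[OF morD(2)[OF g(1)] T(5)] by simp
qed

end


section \<open>Extension-closed subcategories\<close>


lemma restrict_to_simps [simp]:
  "objs (restrict_to C D) = D" "Hom (restrict_to C D) = Hom C" "cmp (restrict_to C D) = cmp C"
  "ident (restrict_to C D) = ident C" "EE (restrict_to C D) = EE C" "push (restrict_to C D) = push C"
  "pull (restrict_to C D) = pull C" "rlz (restrict_to C D) = rlz C"
  by (simp_all add: restrict_to_def)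

lemma isomorphism_restrict [simp]: "isomorphism (restrict_to C D) A B f \<longleftrightarrow> isomorphism C A B f"
  by (simp add: isomorphism_def)

lemma isomorphic_restrict [simp]: "isomorphic (restrict_to C D) A B \<longleftrightarrow> isomorphic C A B"
  by (simp add: isomorphic_def)

lemma etriangle_restrict:
  "D \<subseteq> objs C \<Longrightarrow> etriangle (restrict_to C D) A x B y Z d \<longleftrightarrow>
     A \<in> D \<and> B \<in> D \<and> Z \<in> D \<and> etriangle C A x B y Z d"
  by (auto simp: etriangle_def)

lemma biproduct_restrict:
  "D \<subseteq> objs C \<Longrightarrow> biproduct (restrict_to C D) A A' S i i' p p' \<longleftrightarrow>
     A \<in> D \<and> A' \<in> D \<and> S \<in> D \<and> biproduct C A A' S i i' p p'"
  by (auto simp: biproduct_def)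

text \<open>
  Apart from a zero object, every object whose existence the axioms assert is the middle term of a
  triangle with ends in \<open>D\<close>: for realizations and biproducts this is immediate, and for the new
  object of (ET4) and its dual it is the triangle through the two given cones or cocones.
\<close>

lemma restrict_extriangulated:
  fixes C :: "('o, 'm, 'k, 'e) extri_cat"
  assumes C: "extriangulated_category K C" and D: "subcategory C D" "extension_closed C D"
    and Z: "zero_object C Z0" "Z0 \<in> D"
  shows "extriangulated_category K (restrict_to C D)"
proof -
  interpret extriangulated_category K C by (rule C)
  have DC: "D \<subseteq> objs C" and Diso: "\<And>A B. \<lbrakk>A \<in> D; B \<in> objs C; isomorphic C A B\<rbrakk> \<Longrightarrow> B \<in> D"
    using D(1) by (auto simp: subcategory_def)
  have o: "A \<in> objs C" if "A \<in> D" for A using that DC by blast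
  have Dext: "B \<in> D" if "etriangle C A x B y Z d" "A \<in> D" "Z \<in> D" for A x B y Z d
    using that D(2) unfolding extension_closed_def by blast
  let ?T = "restrict_to C D"
  note et = etriangle_restrict[OF DC] and bp = biproduct_restrict[OF DC]
  have lin: "linear_category K ?T"
    by (intro linear_category.intro linear_category_axioms.intro field_axioms; simp only: restrict_to_simps)
      (rule hom_module hom_disjoint cmp_closed cmp_assoc ident_closed ident_right ident_left
        cmp_add_right cmp_add_left cmp_smult_right cmp_smult_left; (rule o)?; assumption)+
  have add: "additive_linear_category K ?T"
  proof (intro additive_linear_category.intro additive_linear_category_axioms.intro lin)
    show "\<exists>Z. zero_object ?T Z" using Z o by (auto simp: zero_object_def)
    fix A A' assume A: "A \<in> objs ?T" "A' \<in> objs ?T"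
    then obtain S i i' p p' where S: "biproduct C A A' S i i' p p'" using ex_biproduct o by force
    then show "\<exists>S i i' p p'. biproduct ?T A A' S i i' p p'"
      using A Dext[OF split_etri[OF S]] unfolding bp restrict_to_simps by blast
  qed
  have seq: "seq_equiv ?T A Z (x, y) s \<longleftrightarrow> seq_equiv C A Z (x, y) s"
    if a: "A \<in> D" "Z \<in> D" "B \<in> D" "x \<in> arr C A B" "y \<in> arr C B Z" for A Z B x y s
  proof
    assume "seq_equiv ?T A Z (x, y) s"
    then show "seq_equiv C A Z (x, y) s" unfolding seq_equiv_def using o
      by (cases s) (simp, blast)
  next
    assume "seq_equiv C A Z (x, y) s"
    then obtain x' y' B1 B' b where s: "s = (x', y')" "B1 \<in> objs C" "B' \<in> objs C" "x \<in> arr C A B1" "y \<in> arr C B1 Z"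
       "x' \<in> arr C A B'" "y' \<in> arr C B' Z" "isomorphism C B1 B' b" "b \<cdot>\<^bsub>C\<^esub> x = x'" "y' \<cdot>\<^bsub>C\<^esub> b = y"
      unfolding seq_equiv_def by (cases s) auto
    have B1: "B1 = B" using hom_disjoint[OF o[OF a(1)] s(2) o[OF a(1)] o[OF a(3)] s(4) a(4)] by simp
    have "B' \<in> D" using Diso[OF a(3) s(3)] s(8) B1 unfolding isomorphic_def by blast
    then show "seq_equiv ?T A Z (x, y) s" unfolding seq_equiv_def using s B1 a(3) by auto
  qed
  have real: "realization ?T"
    unfolding realization_def
  proof (intro conjI ballI allI impI)
    fix A Z d assume a: "A \<in> objs ?T" "Z \<in> objs ?T" "d \<in> exts ?T Z A"
    then have a': "A \<in> D" "Z \<in> D" "d \<in> exts C Z A" by auto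
    from rlz_class[OF o[OF a'(1)] o[OF a'(2)] a'(3)] obtain x B y
      where t: "etriangle C A x B y Z d" and r: "rlz C Z A d = {s. seq_equiv C A Z (x, y) s}" .
    note B = etriD(2)[OF t] morD(3)[OF etriD(4)[OF t]] morD(3)[OF etriD(5)[OF t]]
    have BD: "B \<in> D" using Dext[OF t] a' by blast
    show "\<exists>B\<in>objs ?T. \<exists>x\<in>arr ?T A B. \<exists>y\<in>arr ?T B Z. rlz ?T Z A d = {s. seq_equiv ?T A Z (x, y) s}"
      unfolding restrict_to_simps seq[OF a'(1,2) BD B(2,3), symmetric]
    proof (intro bexI)
      show "rlz C Z A d = {s. seq_equiv ?T A Z (x, y) s}"
        unfolding r seq[OF a'(1,2) BD B(2,3)] ..
    qed (use BD B in auto)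
  next
    fix A x B y Z d A' x' B' y' Z' d' a c
    assume "etriangle ?T A x B y Z d \<and> etriangle ?T A' x' B' y' Z' d' \<and> a \<in> arr ?T A A' \<and>
       c \<in> arr ?T Z Z' \<and> push ?T Z a d = pull ?T c A' d'"
    then show "\<exists>b\<in>arr ?T B B'. b \<cdot>\<^bsub>?T\<^esub> x = x' \<cdot>\<^bsub>?T\<^esub> a \<and> y' \<cdot>\<^bsub>?T\<^esub> b = c \<cdot>\<^bsub>?T\<^esub> y"
      using realization_laws(2)[rule_format, of A x B y Z d A' x' B' y' Z' d' a c] by (auto simp: et)
  qed
  show ?thesis
  proof (intro extriangulated_category.intro extriangulated_category_axioms.intro add)
    show "biadditive_functor ?T"
      unfolding biadditive_functor_def restrict_to_simps
    proof (intro conjI ballI; (elim o)?)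
    qed (rule bifunctor_laws(1)[rule_format] bifunctor_laws(2)[rule_format] bifunctor_laws(3)[rule_format] bifunctor_laws(4)[rule_format, THEN conjunct1]
        bifunctor_laws(4)[rule_format, THEN conjunct2] bifunctor_laws(5)[rule_format] bifunctor_laws(6)[rule_format] bifunctor_laws(7)[rule_format] bifunctor_laws(8)[rule_format] bifunctor_laws(9)[rule_format];
        (rule o)?; assumption)+
    show "additive_realization ?T"
      unfolding additive_realization_def
    proof (intro conjI allI impI real)
      fix A Z B i i' p p'
      assume "biproduct ?T A Z B i i' p p'"
      then show "etriangle ?T A i B p' Z \<zero>\<^bsub>EE ?T Z A\<^esub>" using split_etri by (auto simp: bp et)
    next
      fix A x B y Z d A' x' B' y' Z' d' AA i i' p p' BB j j' q q' ZZ k k' r r'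
      assume a: "etriangle ?T A x B y Z d \<and> etriangle ?T A' x' B' y' Z' d' \<and>
        biproduct ?T A A' AA i i' p p' \<and> biproduct ?T B B' BB j j' q q' \<and> biproduct ?T Z Z' ZZ k k' r r'"
      then have "etriangle C A x B y Z d \<and> etriangle C A' x' B' y' Z' d' \<and>
        biproduct C A A' AA i i' p p' \<and> biproduct C B B' BB j j' q q' \<and> biproduct C Z Z' ZZ k k' r r'"
        by (simp add: et bp)
      from additive_realization[unfolded additive_realization_def, THEN conjunct2, THEN conjunct2, rule_format, OF this]
      show "etriangle ?T
          AA ((j \<cdot>\<^bsub>?T\<^esub> x \<cdot>\<^bsub>?T\<^esub> p) \<oplus>\<^bsub>Hom ?T AA BB\<^esub> (j' \<cdot>\<^bsub>?T\<^esub> x' \<cdot>\<^bsub>?T\<^esub> p'))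
          BB ((k \<cdot>\<^bsub>?T\<^esub> y \<cdot>\<^bsub>?T\<^esub> q) \<oplus>\<^bsub>Hom ?T BB ZZ\<^esub> (k' \<cdot>\<^bsub>?T\<^esub> y' \<cdot>\<^bsub>?T\<^esub> q'))
          ZZ (push ?T ZZ i (pull ?T r A d) \<oplus>\<^bsub>EE ?T ZZ AA\<^esub> push ?T ZZ i' (pull ?T r' A' d'))"
        using a by (simp add: et bp)
    qed
    show "ET3 ?T" unfolding ET3_def
    proof (intro allI impI)
      fix A x B y Z d A' x' B' y' Z' d' a b
      assume "etriangle ?T A x B y Z d \<and> etriangle ?T A' x' B' y' Z' d' \<and>
       a \<in> arr ?T A A' \<and> b \<in> arr ?T B B' \<and> b \<cdot>\<^bsub>?T\<^esub> x = x' \<cdot>\<^bsub>?T\<^esub> a"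
      then show "\<exists>c\<in>arr ?T Z Z'. y' \<cdot>\<^bsub>?T\<^esub> b = c \<cdot>\<^bsub>?T\<^esub> y \<and> push ?T Z a d = pull ?T c A' d'"
        using ET3[unfolded ET3_def, rule_format, of A x B y Z d A' x' B' y' Z' d' a b] by (simp add: et)
    qed
    show "ET3_op ?T" unfolding ET3_op_def
    proof (intro allI impI)
      fix A x B y Z d A' x' B' y' Z' d' b c
      assume "etriangle ?T A x B y Z d \<and> etriangle ?T A' x' B' y' Z' d' \<and>
       b \<in> arr ?T B B' \<and> c \<in> arr ?T Z Z' \<and> y' \<cdot>\<^bsub>?T\<^esub> b = c \<cdot>\<^bsub>?T\<^esub> y"
      then show "\<exists>a\<in>arr ?T A A'. b \<cdot>\<^bsub>?T\<^esub> x = x' \<cdot>\<^bsub>?T\<^esub> a \<and> push ?T Z a d = pull ?T c A' d'"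
        using ET3_op[unfolded ET3_op_def, rule_format, of A x B y Z d A' x' B' y' Z' d' b c] by (simp add: et)
    qed
    show "ET4 ?T" unfolding ET4_def
    proof (intro allI impI)
      fix A f B f' E d1 g H g' G d2
      assume a: "etriangle ?T A f B f' E d1 \<and> etriangle ?T B g H g' G d2"
      then have a': "etriangle C A f B f' E d1" "etriangle C B g H g' G d2" "A \<in> D" "E \<in> D" "G \<in> D" "H \<in> D"
        by (auto simp: et)
      from etri_ET4[OF a'(1,2)] obtain F h' d e d3 where F: "mor h' H F" "h' \<cdot>\<^bsub>C\<^esub> g = d \<cdot>\<^bsub>C\<^esub> f'" "e \<cdot>\<^bsub>C\<^esub> h' = g'"
        "etriangle C A (g \<cdot>\<^bsub>C\<^esub> f) H h' F d3" "etriangle C E d F e G (push C G f' d2)"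
        "pull C d A d3 = d1" "push C F f d3 = pull C e B d2" .
      have "F \<in> D" using Dext[OF F(5)] a' by blast
      then show "\<exists>F\<in>objs ?T. \<exists>h'\<in>arr ?T H F. \<exists>d\<in>arr ?T E F. \<exists>e\<in>arr ?T F G. \<exists>d3\<in>exts ?T F A.
        h' \<cdot>\<^bsub>?T\<^esub> g = d \<cdot>\<^bsub>?T\<^esub> f' \<and> e \<cdot>\<^bsub>?T\<^esub> h' = g' \<and>
        etriangle ?T A (g \<cdot>\<^bsub>?T\<^esub> f) H h' F d3 \<and> etriangle ?T E d F e G (push ?T G f' d2) \<and>
        pull ?T d A d3 = d1 \<and> push ?T F f d3 = pull ?T e B d2"
        unfolding restrict_to_simps et using F a' etriD(4-6)[OF F(5)] etriD(6)[OF F(4)] unfolding mor_def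
        by (intro bexI[of _ F] bexI[of _ h'] bexI[of _ d] bexI[of _ e] bexI[of _ d3]) simp_all
    qed
    show "ET4_op ?T" unfolding ET4_op_def
    proof (intro allI impI)
      fix A f B f' E d1 g H g' G d2
      assume a: "etriangle ?T E f' B f A d1 \<and> etriangle ?T G g' H g B d2"
      then have a': "etriangle C E f' B f A d1" "etriangle C G g' H g B d2" "A \<in> D" "E \<in> D" "G \<in> D" "H \<in> D"
        by (auto simp: et)
      from etri_ET4_op[OF a'(1,2)] obtain F h' d e d3 where F: "mor h' F H" "g \<cdot>\<^bsub>C\<^esub> h' = f' \<cdot>\<^bsub>C\<^esub> d" "h' \<cdot>\<^bsub>C\<^esub> e = g'"
        "etriangle C F h' H (f \<cdot>\<^bsub>C\<^esub> g) A d3" "etriangle C G e F d E (pull C f' G d2)"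
        "push C A d d3 = d1" "pull C f F d3 = push C B e d2" .
      have "F \<in> D" using Dext[OF F(5)] a' by blast
      then show "\<exists>F\<in>objs ?T. \<exists>h'\<in>arr ?T F H. \<exists>d\<in>arr ?T F E. \<exists>e\<in>arr ?T G F. \<exists>d3\<in>exts ?T A F.
        g \<cdot>\<^bsub>?T\<^esub> h' = f' \<cdot>\<^bsub>?T\<^esub> d \<and> h' \<cdot>\<^bsub>?T\<^esub> e = g' \<and>
        etriangle ?T F h' H (f \<cdot>\<^bsub>?T\<^esub> g) A d3 \<and> etriangle ?T G e F d E (pull ?T f' G d2) \<and>
        push ?T A d d3 = d1 \<and> pull ?T f F d3 = push ?T B e d2"
        unfolding restrict_to_simps et using F a' etriD(4-6)[OF F(5)] etriD(6)[OF F(4)] unfolding mor_def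
        by (intro bexI[of _ F] bexI[of _ h'] bexI[of _ d] bexI[of _ e] bexI[of _ d3]) simp_all
    qed
  qed
qed

section \<open>Objects filtered by a semibrick\<close>


locale semibrick_in_extriangulated = extriangulated_category K C
  for K :: "('k, 'r) ring_scheme" (structure) and C :: "('o, 'm, 'k, 'e, 'z) extri_cat_scheme" +
  fixes \<X> :: "'o set"
  assumes semibrick: "semibrick C \<X>"
begin

lemma brick_objs: "X \<in> \<X> \<Longrightarrow> X \<in> objs C"
  using semibrick by (auto simp: semibrick_def subcategory_def)

lemma brick_nonzero_endo_iso:
  assumes X: "X \<in> \<X>" and f: "mor f X X" "f \<noteq> zmor X X" shows "isomorphism C X X f"
proof -
  have "division_ring (End_ring C X)" using semibrick X by (auto simp: semibrick_def brick_def)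
  then have "Units (End_ring C X) = arr C X X - {zmor X X}"
    by (simp add: division_ring_def End_ring_def)
  then have "f \<in> Units (End_ring C X)" using f morD(3) by simp
  then show ?thesis by (auto simp: Units_def End_ring_def isomorphism_def)
qed

lemma brick_ident_nonzero: "X \<in> \<X> \<Longrightarrow> ident C X \<noteq> zmor X X"
  using semibrick by (auto simp: semibrick_def brick_def division_ring_def End_ring_def)

text \<open>
  Between isomorphic bricks, composing with an isomorphism gives a nonzero endomorphism of a
  brick.
\<close>

lemma nonzero_between_bricks_iso:
  assumes X: "X \<in> \<X>" "Y \<in> \<X>" and f: "mor f X Y" "f \<noteq> zmor X Y" shows "isomorphism C X Y f"
proof -
  note o = brick_objs[OF X(1)] brick_objs[OF X(2)]
  have "isomorphic C X Y" using semibrick X f by (auto simp: semibrick_def mor_def)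
  then obtain h where "isomorphism C X Y h" by (auto simp: isomorphic_def)
  from isoE[OF this o] obtain g where g: "mor h X Y" "mor g Y X" "g \<cdot>\<^bsub>C\<^esub> h = ident C X" "h \<cdot>\<^bsub>C\<^esub> g = ident C Y" .
  have "g \<cdot>\<^bsub>C\<^esub> f \<noteq> zmor X X"
    using mor_assoc[OF f(1) g(2,1)] g(4) id_left[OF f(1)] cmp_zero_right[OF o(1) g(1)] f(2) by metis
  moreover have "f \<cdot>\<^bsub>C\<^esub> g \<noteq> zmor Y Y"
    using mor_assoc[OF g(1,2) f(1)] g(3) id_right[OF f(1)] cmp_zero_left[OF o(2) g(1)] f(2) by metis
  ultimately show ?thesis
    by (intro iso_of_iso_comps[OF f(1) g(2)] brick_nonzero_endo_iso X mor_cmp[OF f(1) g(2)] mor_cmp[OF g(2) f(1)])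
qed

text \<open>
  Let \<open>M'\<close> be the penultimate term of the filtration of \<open>M\<close>, with cone \<open>Z\<close>. If \<open>f\<close> vanishes on
  \<open>M'\<close>, it factors through a nonzero morphism of bricks \<open>Z \<rightarrow> X\<close>, an isomorphism. Otherwise the
  restriction of \<open>f\<close> to \<open>M'\<close> is a deflation with cocone \<open>A\<close> by induction. With \<open>F\<close> the cone of
  \<open>A \<rightarrow> M\<close>, the conflation \<open>X \<rightarrow> F \<rightarrow> Z\<close> is split by the morphism \<open>F \<rightarrow> X\<close> that \<open>f\<close> induces, which
  is therefore a deflation with cocone \<open>Z\<close>; so \<open>f\<close> is a composite of deflations \<open>M \<rightarrow> F \<rightarrow> X\<close>, and its
  cocone is an extension of \<open>Z\<close> by \<open>A\<close>.
\<close>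

lemma nonzero_to_brick_deflation:
  assumes Y: "\<Y> \<subseteq> \<X>" and X: "X \<in> \<X>"
  shows "\<lbrakk>filtered \<Y> n M; mor f M X; f \<noteq> zmor M X\<rbrakk>
    \<Longrightarrow> \<exists>m A x d. n = Suc m \<and> filtered \<Y> m A \<and> etriangle C A x M f X d"
proof (induction n arbitrary: M f)
  case 0
  then show ?case using zero_object_from by simp
next
  case (Suc n)
  obtain M' m z Z d2 where M: "filtered \<Y> n M'" "Z \<in> \<Y>" and t: "etriangle C M' m M z Z d2" using Suc.prems by auto
  note T = etriD[OF t] and f = Suc.prems(2,3)
  show ?case
  proof (cases "f \<cdot>\<^bsub>C\<^esub> m = zmor M' X")
    case True
    from factor_through_deflation[OF t f(1) True] obtain g where g: "mor g Z X" "f = g \<cdot>\<^bsub>C\<^esub> z" .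
    have "g \<noteq> zmor Z X" using g f(2) cmp_zero_left[OF morD(2)[OF g(1)] T(5)] by auto
    then have "isomorphism C Z X g" using nonzero_between_bricks_iso[OF _ X g(1)] M(2) Y by blast
    from isoE[OF this T(3) brick_objs[OF X]]
    obtain g' where "mor g' X Z" "g' \<cdot>\<^bsub>C\<^esub> g = ident C Z" "g \<cdot>\<^bsub>C\<^esub> g' = ident C X" by metis
    from etri_right_iso[OF t g(1) this] M(1) g(2) show ?thesis by blast
  next
    case False
    have mfm: "mor (f \<cdot>\<^bsub>C\<^esub> m) M' X" by (rule mor_cmp[OF T(4) f(1)])
    from Suc.IH[OF M(1) mfm False] obtain k A x d1
      where n: "n = Suc k" and A: "filtered \<Y> k A" and t1: "etriangle C A x M' (f \<cdot>\<^bsub>C\<^esub> m) X d1" by blast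
    note T1 = etriD[OF t1]
    from etri_ET4[OF t1 t] obtain F h' d e d3 where
      h: "mor h' M F" "h' \<cdot>\<^bsub>C\<^esub> m = d \<cdot>\<^bsub>C\<^esub> (f \<cdot>\<^bsub>C\<^esub> m)" "e \<cdot>\<^bsub>C\<^esub> h' = z"
      and tF: "etriangle C A (m \<cdot>\<^bsub>C\<^esub> x) M h' F d3" and tG: "etriangle C X d F e Z (push C Z (f \<cdot>\<^bsub>C\<^esub> m) d2)" by metis
    note TF = etriD[OF tF] and TG = etriD[OF tG]
    have "f \<cdot>\<^bsub>C\<^esub> (m \<cdot>\<^bsub>C\<^esub> x) = zmor A X"
      using mor_assoc[OF T1(4) T(4) f(1)] etri_comp_zero[OF t1] by simp
    from factor_through_deflation[OF tF f(1) this] obtain r where r: "mor r F X" "f = r \<cdot>\<^bsub>C\<^esub> h'" .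
    have mrd: "mor (r \<cdot>\<^bsub>C\<^esub> d) X X" by (rule mor_cmp[OF TG(4) r(1)])
    have rd: "(r \<cdot>\<^bsub>C\<^esub> d) \<cdot>\<^bsub>C\<^esub> (f \<cdot>\<^bsub>C\<^esub> m) = f \<cdot>\<^bsub>C\<^esub> m"
      unfolding mor_assoc[OF mfm TG(4) r(1)] h(2)[symmetric] mor_assoc[OF T(4) h(1) r(1), symmetric] r(2)[symmetric] ..
    \<comment> \<open>\<open>r \<cdot> d - 1\<close> kills \<open>f \<cdot> m \<noteq> 0\<close>, so it is not invertible, hence zero\<close>
    have rd1: "r \<cdot>\<^bsub>C\<^esub> d = ident C X"
    proof (rule ccontr)
      let ?n = "(r \<cdot>\<^bsub>C\<^esub> d) \<ominus>\<^bsub>Hom C X X\<^esub> ident C X"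
      note I = mor_ident[OF brick_objs[OF X]]
      have mn: "mor ?n X X" by (rule mor_minus[OF mrd I])
      assume "r \<cdot>\<^bsub>C\<^esub> d \<noteq> ident C X"
      then have "?n \<noteq> zmor X X" using minus_zero_iff[OF mrd I] by simp
      from isoE[OF brick_nonzero_endo_iso[OF X mn this] brick_objs[OF X] brick_objs[OF X]]
      obtain v where v: "mor v X X" "v \<cdot>\<^bsub>C\<^esub> ?n = ident C X" by metis
      have "?n \<cdot>\<^bsub>C\<^esub> (f \<cdot>\<^bsub>C\<^esub> m) = zmor M' X"
        unfolding minus_left[OF mfm mrd I] rd id_left[OF mfm] using minus_zero_iff[OF mfm mfm] by simp
      then have "f \<cdot>\<^bsub>C\<^esub> m = zmor M' X"
        using mor_assoc[OF mfm mn v(1)] v(2) id_left[OF mfm] cmp_zero_right[OF T(1) v(1)] by simp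
      then show False using False by simp
    qed
    from split_of_retraction[OF tG r(1) rd1] obtain s where "biproduct C X Z F d s r e" .
    from split_etri[OF biproduct_swap[OF this]] have "etriangle C Z s F r X (zext X Z)" .
    from etri_ET4_op[OF this tF] obtain E e' c' d' d4 where
      tM: "etriangle C E e' M f X d4" and tE: "etriangle C A c' E d' Z (pull C s A d3)"
      unfolding r(2) by metis
    have "filtered \<Y> (Suc k) E" by (rule filtered_SucI[OF A M(2) tE])
    then show ?thesis using tM n by blast
  qed
qed

lemma filtered_cocone:
  assumes "\<Y> \<subseteq> \<X>" "X \<in> \<X>" "filtered \<Y> n M" "etriangle C A x M f X d" "f \<noteq> zmor M X"
  obtains m where "n = Suc m" "filtered \<Y> m A"
proof -
  obtain m A' x' d' where m: "n = Suc m" "filtered \<Y> m A'" "etriangle C A' x' M f X d'"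
    using nonzero_to_brick_deflation[OF assms(1-3) etriD(5)[OF assms(4)] assms(5)] by blast
  show thesis
    using that m(1) filtered_iso[OF m(2) cocone_unique[OF m(3) assms(4)] etriD(1)[OF assms(4)]] by blast
qed

lemma iso_subsetD: "\<S> \<in> iso_subsets C \<X> \<Longrightarrow> \<S> \<subseteq> \<X>"
  by (simp add: iso_subsets_def)

lemma iso_subset_iso:
  assumes "\<S> \<in> iso_subsets C \<X>" "X \<in> \<S>" "Y \<in> objs C" "isomorphic C X Y" shows "Y \<in> \<S>"
  using assms by (auto simp: iso_subsets_def subcategory_def)

text \<open>
  Otherwise the bricks in \<open>\<S>\<close> have no nonzero morphisms to \<open>X\<close>, and neither has any object filtered by
  them.
\<close>

lemma brick_top_in:
  assumes S: "\<S> \<in> iso_subsets C \<X>" and X: "X \<in> \<X>" and M: "M \<in> Filt C \<S>" and f: "mor f M X" "f \<noteq> zmor M X"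
  shows "X \<in> \<S>"
proof (rule ccontr)
  assume n: "X \<notin> \<S>"
  obtain n where "filtered \<S> n M" using M Filt_iff by blast
  moreover have "g = zmor Z X" if "Z \<in> \<S>" "mor g Z X" for Z g
    using nonzero_between_bricks_iso[OF _ X that(2)] iso_subsetD[OF S] that(1) iso_subset_iso[OF S that(1) brick_objs[OF X]] n
    unfolding isomorphic_def by blast
  ultimately show False using hom_from_filtered_zero f by blast
qed

lemma brick_in_Filt:
  assumes S: "\<S> \<in> iso_subsets C \<X>" and X: "X \<in> \<X>" "X \<in> Filt C \<S>" shows "X \<in> \<S>"
  using brick_top_in[OF S X(1) X(2) mor_ident[OF brick_objs[OF X(1)]] brick_ident_nonzero[OF X(1)]] .

lemma Filt_subset_iff:
  assumes S: "\<S> \<in> iso_subsets C \<X>" "\<S>' \<in> iso_subsets C \<X>"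
  shows "Filt C \<S> \<subseteq> Filt C \<S>' \<longleftrightarrow> \<S> \<subseteq> \<S>'"
proof
  assume F: "Filt C \<S> \<subseteq> Filt C \<S>'"
  show "\<S> \<subseteq> \<S>'"
  proof
    fix X assume X: "X \<in> \<S>"
    then have XX: "X \<in> \<X>" using iso_subsetD[OF S(1)] by (rule rev_subsetD)
    have "X \<in> Filt C \<S>'" using F generators_in_Filt[OF X brick_objs[OF XX]] by (rule subsetD)
    then show "X \<in> \<S>'" by (rule brick_in_Filt[OF S(2) XX])
  qed
qed (rule Filt_mono)

text \<open>
  If \<open>M\<close> had no nonzero morphism to any member of \<open>\<Y>\<close>, it would have none to itself, as \<open>M\<close> is filtered by
  \<open>\<Y>\<close>.
\<close>

lemma nonzero_has_brick_top:
  assumes M: "M \<in> Filt C \<Y>" "\<not> zero_object C M"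
  obtains X f where "X \<in> \<Y>" "mor f M X" "f \<noteq> zmor M X"
proof -
  obtain n where n: "filtered \<Y> n M" using M Filt_iff by blast
  note o = filtered_objs[OF n]
  have "ident C M \<noteq> zmor M M" using M(2) zero_object_iff o by blast
  then obtain Z g where "Z \<in> \<Y>" "mor g M Z" "g \<noteq> zmor M Z"
    using hom_into_filtered_zero[OF _ n mor_ident[OF o]] by metis
  then show thesis by (rule that)
qed

text \<open>
  A nonzero morphism from \<open>M\<close> to a brick \<open>X\<close> is seen by all \<open>\<S>\<close> in \<open>\<F>\<close> at once: \<open>X\<close> lies in each of
  them, and the cocone is filtered by each of them.
\<close>

lemma Filt_Inter:
  assumes F: "\<F> \<subseteq> iso_subsets C \<X>" "\<F> \<noteq> {}" and M: "\<And>\<S>. \<S> \<in> \<F> \<Longrightarrow> M \<in> Filt C \<S>"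
  shows "M \<in> Filt C (\<Inter>\<F>)"
proof -
  obtain \<S>0 where S0: "\<S>0 \<in> \<F>" using F by blast
  obtain n where "filtered \<S>0 n M" using M[OF S0] Filt_iff by blast
  then show ?thesis using M
  proof (induction n arbitrary: M rule: less_induct)
    case (less n)
    show ?case
    proof (cases "zero_object C M")
      case True
      then show ?thesis by (rule zero_in_Filt)
    next
      case False
      from nonzero_has_brick_top[OF less.prems(2)[OF S0] False]
      obtain X f where X: "X \<in> \<S>0" "mor f M X" "f \<noteq> zmor M X" .
      have XX: "X \<in> \<X>" using X(1) S0 F(1) iso_subsetD by blast
      have XF: "X \<in> \<Inter>\<F>" using brick_top_in[OF _ XX less.prems(2) X(2,3)] F(1) by blast
      from nonzero_to_brick_deflation[OF iso_subsetD XX less.prems(1) X(2,3)] S0 F(1)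
      obtain m A x d where A: "n = Suc m" "filtered \<S>0 m A" "etriangle C A x M f X d" by blast
      have "A \<in> Filt C \<S>" if S: "\<S> \<in> \<F>" for \<S>
      proof -
        obtain k where k: "filtered \<S> k M" using less.prems(2)[OF S] Filt_iff by blast
        have "\<S> \<subseteq> \<X>" using iso_subsetD S F(1) by blast
        from filtered_cocone[OF this XX k A(3) X(3)] show ?thesis unfolding Filt_iff by metis
      qed
      then have "A \<in> Filt C (\<Inter>\<F>)" using less.IH[of m A] A by simp
      then show ?thesis by (rule Filt_extend[OF _ XF A(3)])
    qed
  qed
qed

text \<open>
  A nonzero morphism \<open>f\<close> from \<open>M\<close> to a brick \<open>X\<close> stays nonzero when composed with \<open>p\<close>, so \<open>X\<close> lies in
  \<open>\<S>\<close>, and the cocone of \<open>f\<close> is a retract of the cocone of \<open>f \<cdot> p\<close>, which is filtered by \<open>\<S>\<close>.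
\<close>

lemma Filt_retract:
  assumes S: "\<S> \<in> iso_subsets C \<X>" and M: "M \<in> Filt C \<X>" and U: "U \<in> Filt C \<S>"
    and r: "mor i M U" "mor p U M" "p \<cdot>\<^bsub>C\<^esub> i = ident C M"
  shows "M \<in> Filt C \<S>"
proof -
  obtain n where "filtered \<X> n M" using M Filt_iff by blast
  then show ?thesis using U r
  proof (induction n arbitrary: M U i p rule: less_induct)
    case (less n)
    note U = less.prems(2) and i = less.prems(3) and p = less.prems(4) and pi = less.prems(5)
    show ?case
    proof (cases "zero_object C M")
      case True
      then show ?thesis by (rule zero_in_Filt)
    next
      case False
      have "M \<in> Filt C \<X>" using less.prems(1) Filt_iff by blast
      from nonzero_has_brick_top[OF this False] obtain X f where X: "X \<in> \<X>" "mor f M X" "f \<noteq> zmor M X" .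
      obtain m A x d where A: "n = Suc m" "filtered \<X> m A" and t: "etriangle C A x M f X d"
        using nonzero_to_brick_deflation[OF subset_refl X(1) less.prems(1) X(2,3)] by blast
      have mfp: "mor (f \<cdot>\<^bsub>C\<^esub> p) U X" by (rule mor_cmp[OF p X(2)])
      have fpi: "(f \<cdot>\<^bsub>C\<^esub> p) \<cdot>\<^bsub>C\<^esub> i = f" using mor_assoc[OF i p X(2)] pi id_right[OF X(2)] by simp
      have fp: "f \<cdot>\<^bsub>C\<^esub> p \<noteq> zmor U X" using fpi X(3) cmp_zero_left[OF morD(2)[OF X(2)] i] by auto
      have XS: "X \<in> \<S>" by (rule brick_top_in[OF S X(1) U mfp fp])
      obtain k where k: "filtered \<S> k U" using U Filt_iff by blast
      obtain l A' x' d' where A': "filtered \<S> l A'" and t': "etriangle C A' x' U (f \<cdot>\<^bsub>C\<^esub> p) X d'"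
        using nonzero_to_brick_deflation[OF iso_subsetD[OF S] X(1) k mfp fp] by blast
      note T = etriD[OF t] and T' = etriD[OF t']
      have "(f \<cdot>\<^bsub>C\<^esub> p) \<cdot>\<^bsub>C\<^esub> i = ident C X \<cdot>\<^bsub>C\<^esub> f" using fpi id_left[OF X(2)] by simp
      from etri_ET3_op[OF t t' i mor_ident[OF T(3)] this] obtain a
        where a: "mor a A A'" "i \<cdot>\<^bsub>C\<^esub> x = x' \<cdot>\<^bsub>C\<^esub> a" "push C X a d = d'"
        unfolding pull_ident[OF T'(1,3,6)] .
      have "f \<cdot>\<^bsub>C\<^esub> p = ident C X \<cdot>\<^bsub>C\<^esub> (f \<cdot>\<^bsub>C\<^esub> p)" using id_left[OF mfp] by simp
      from etri_ET3_op[OF t' t p mor_ident[OF T(3)] this] obtain a'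
        where a': "mor a' A' A" "p \<cdot>\<^bsub>C\<^esub> x' = x \<cdot>\<^bsub>C\<^esub> a'" "push C X a' d' = d"
        unfolding pull_ident[OF T(1,3,6)] .
      \<comment> \<open>\<open>a' \<cdot> a\<close> need not be the identity of \<open>A\<close>, but it is invertible\<close>
      have "isomorphism C A A (a' \<cdot>\<^bsub>C\<^esub> a)"
      proof (rule etri_endo_left_iso[OF t mor_cmp[OF a(1) a'(1)]])
        show "x \<cdot>\<^bsub>C\<^esub> (a' \<cdot>\<^bsub>C\<^esub> a) = x"
          unfolding mor_assoc[OF a(1) a'(1) T(4), symmetric] a'(2)[symmetric] mor_assoc[OF a(1) T'(4) p] a(2)[symmetric]
            mor_assoc[OF T(4) i p, symmetric] pi id_left[OF T(4)] ..
        show "push C X (a' \<cdot>\<^bsub>C\<^esub> a) d = d" unfolding push_cmp[OF a(1) a'(1) T(3,6)] a(3) a'(3) ..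
      qed
      from isoE[OF this T(1) T(1)] obtain v where v: "mor v A A" "v \<cdot>\<^bsub>C\<^esub> (a' \<cdot>\<^bsub>C\<^esub> a) = ident C A" by metis
      have "(v \<cdot>\<^bsub>C\<^esub> a') \<cdot>\<^bsub>C\<^esub> a = ident C A" using mor_assoc[OF a(1) a'(1) v(1)] v(2) by simp
      moreover have "A' \<in> Filt C \<S>" using A' Filt_iff by blast
      ultimately have "A \<in> Filt C \<S>" using less.IH[of m A A' a "v \<cdot>\<^bsub>C\<^esub> a'"] A a(1) mor_cmp[OF a'(1) v(1)] by simp
      then show ?thesis by (rule Filt_extend[OF _ XS t])
    qed
  qed
qed

text \<open>
  Adding a top factor \<open>Z\<close> to an object with decomposition \<open>U \<rightarrow> M' \<rightarrow> F\<close> replaces \<open>F\<close> by an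
  extension \<open>E\<close> of \<open>Z\<close> by \<open>F\<close>. If some brick in \<open>\<S>\<close> maps nontrivially to \<open>E\<close>, it does so to \<open>Z\<close>,
  hence is isomorphic to \<open>Z\<close> and splits \<open>E \<rightarrow> Z\<close>; then \<open>Z\<close> can be moved into \<open>U\<close>.
\<close>

lemma torsion_decomposition:
  assumes S: "\<S> \<in> iso_subsets C \<X>" and M: "M \<in> Filt C \<X>"
  obtains U x y F d where "etriangle C U x M y F d" "U \<in> Filt C \<S>" "\<And>Z g. \<lbrakk>Z \<in> \<S>; mor g Z F\<rbrakk> \<Longrightarrow> g = zmor Z F"
proof -
  obtain n where "filtered \<X> n M" using M Filt_iff by blast
  then have "\<exists>U x y F d. etriangle C U x M y F d \<and> U \<in> Filt C \<S> \<and> (\<forall>Z\<in>\<S>. \<forall>g. mor g Z F \<longrightarrow> g = zmor Z F)"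
  proof (induction n arbitrary: M)
    case 0
    then have z: "zero_object C M" by simp
    then have "etriangle C M (ident C M) M (zmor M M) M (zext M M)" using etri_id_left zero_object_iff by blast
    moreover have "\<forall>Z\<in>\<S>. \<forall>g. mor g Z M \<longrightarrow> g = zmor Z M" using zero_object_to[OF z] by blast
    ultimately show ?case using zero_in_Filt[OF z] by blast
  next
    case (Suc n)
    obtain M' m z Z d2 where M: "filtered \<X> n M'" "Z \<in> \<X>" and t: "etriangle C M' m M z Z d2" using Suc.prems by auto
    obtain U u v F d1 where t1: "etriangle C U u M' v F d1" and U: "U \<in> Filt C \<S>"
      and F: "\<forall>Z\<in>\<S>. \<forall>g. mor g Z F \<longrightarrow> g = zmor Z F" using Suc.IH[OF M(1)] by blast
    from etri_ET4[OF t1 t] obtain E h' d e d3 where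
      tE: "etriangle C U (m \<cdot>\<^bsub>C\<^esub> u) M h' E d3" and tG: "etriangle C F d E e Z (push C Z v d2)" by metis
    note TG = etriD[OF tG]
    show ?case
    proof (cases "\<forall>W\<in>\<S>. \<forall>g. mor g W E \<longrightarrow> g = zmor W E")
      case True
      then show ?thesis using tE U by blast
    next
      case False
      then obtain W g where W: "W \<in> \<S>" "mor g W E" "g \<noteq> zmor W E" by blast
      have WX: "W \<in> \<X>" using W iso_subsetD[OF S] by blast
      have meg: "mor (e \<cdot>\<^bsub>C\<^esub> g) W Z" by (rule mor_cmp[OF W(2) TG(5)])
      have "e \<cdot>\<^bsub>C\<^esub> g \<noteq> zmor W Z"
      proof
        assume "e \<cdot>\<^bsub>C\<^esub> g = zmor W Z"
        from lift_through_inflation[OF tG W(2) this] obtain g' where g': "mor g' W F" "g = d \<cdot>\<^bsub>C\<^esub> g'" .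
        then show False using F W cmp_zero_right[OF morD(1)[OF W(2)] TG(4)] by blast
      qed
      then have i: "isomorphism C W Z (e \<cdot>\<^bsub>C\<^esub> g)" using nonzero_between_bricks_iso[OF WX M(2) meg] by blast
      then have ZS: "Z \<in> \<S>" using iso_subset_iso[OF S W(1) TG(3)] unfolding isomorphic_def by blast
      from isoE[OF i brick_objs[OF WX] TG(3)] obtain w
        where w: "mor w Z W" "(e \<cdot>\<^bsub>C\<^esub> g) \<cdot>\<^bsub>C\<^esub> w = ident C Z" by metis
      have "e \<cdot>\<^bsub>C\<^esub> (g \<cdot>\<^bsub>C\<^esub> w) = ident C Z" using mor_assoc[OF w(1) W(2) TG(5)] w(2) by simp
      from split_of_section[OF tG mor_cmp[OF w(1) W(2)] this] obtain s r where "biproduct C F Z E d s r e" .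
      from split_etri[OF biproduct_swap[OF this]] have "etriangle C Z s E r F (zext F Z)" .
      from etri_ET4_op[OF this tE] obtain U' x' c' d' d4 where
        t': "etriangle C U' x' M (r \<cdot>\<^bsub>C\<^esub> h') F d4" and tU: "etriangle C U c' U' d' Z (pull C s U d3)" by metis
      have "U' \<in> Filt C \<S>" by (rule Filt_extend[OF U ZS tU])
      then show ?thesis using t' F by blast
    qed
  qed
  then show thesis using that by blast
qed

end


section \<open>Cotorsion pairs of filtration subcategories\<close>


locale length_extriangulated = semibrick_in_extriangulated K C \<X>
  for K :: "('k, 'r) ring_scheme" (structure) and C :: "('o, 'm, 'k, 'e, 'z) extri_cat_scheme" and \<X> +
  assumes generated: "objs C = Filt C \<X>"
begin

lemma Filt_objs: "Filt C \<Y> \<subseteq> objs C"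
  using subcategory_Filt by (simp add: subcategory_def)

text \<open>
  Here \<open>G\<close> is the cocone of \<open>I \<rightarrow> B \<rightarrow> F\<close>, for an injective \<open>I\<close> with inflation \<open>M \<rightarrow> I\<close> and cone \<open>B\<close>, and the
  decomposition \<open>U \<rightarrow> B \<rightarrow> F\<close> of \<open>B\<close>. An extension in \<open>E(W, G)\<close> with \<open>W\<close> in \<open>Filt C \<S>\<close> dies in
  \<open>E(W, I) = 0\<close>, so it comes from a morphism \<open>W \<rightarrow> F\<close>, which is zero.
\<close>

lemma special_preenvelope:
  assumes inj: "enough_injectives C" and S: "\<S> \<in> iso_subsets C \<X>" and M: "M \<in> objs C"
  obtains x G y U d where "etriangle C M x G y U d" "G \<in> perp1 C (Filt C \<S>)" "U \<in> Filt C \<S>"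
proof -
  obtain i I j B d1 where I: "is_injective C I" and tI: "etriangle C M i I j B d1"
    using inj M unfolding enough_injectives_def by blast
  have "B \<in> Filt C \<X>" using etriD(3)[OF tI] generated by simp
  from torsion_decomposition[OF S this] obtain U u v F d2 where
    tU: "etriangle C U u B v F d2" and U: "U \<in> Filt C \<S>" and F: "\<And>Z g. \<lbrakk>Z \<in> \<S>; mor g Z F\<rbrakk> \<Longrightarrow> g = zmor Z F" by metis
  from etri_ET4_op[OF tU tI] obtain G h e c d3 where
    tG: "etriangle C G h I (v \<cdot>\<^bsub>C\<^esub> j) F d3" and tM: "etriangle C M e G c U (pull C u M d1)" by metis
  note T = etriD[OF tG]
  have "G \<in> perp1 C (Filt C \<S>)"
  proof (rule perp1I[OF T(1) _ Filt_objs])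
    fix W \<epsilon> assume W: "W \<in> Filt C \<S>" and \<epsilon>: "\<epsilon> \<in> exts C W G"
    have o: "W \<in> objs C" using W Filt_objs by blast
    have "push C W h \<epsilon> = zext W I" by (rule ext_into_injective[OF I o push_closed[OF T(4) o \<epsilon>]])
    from ext_killed_by_inflation[OF tG o \<epsilon> this] obtain w where w: "mor w W F" "\<epsilon> = pull C w G d3" .
    obtain n where "filtered \<S> n W" using W Filt_iff by blast
    from hom_from_filtered_zero[OF F this w(1)] have "w = zmor W F" .
    then show "\<epsilon> = zext W G" using w(2) pull_zmor[OF T(1) o T(3,6)] by simp
  qed
  then show thesis using that tM U by blast
qed

text \<open>
  Salce's argument: push out \<open>A \<rightarrow> Q \<rightarrow> M\<close> with \<open>Q\<close> projective along the preenvelope of \<open>A\<close>.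
\<close>

lemma special_precover:
  assumes inj: "enough_injectives C" and proj: "enough_projectives C" and S: "\<S> \<in> iso_subsets C \<X>"
    and P: "projectives C \<subseteq> Filt C \<S>" and M: "M \<in> objs C"
  obtains V x U y where "conflation C V x U y M" "V \<in> perp1 C (Filt C \<S>)" "U \<in> Filt C \<S>"
proof -
  obtain A a Q p d1 where Q: "is_projective C Q" and tQ: "etriangle C A a Q p M d1"
    using proj M unfolding enough_projectives_def by blast
  have QS: "Q \<in> Filt C \<S>" using P Q by (auto simp: projectives_def)
  from special_preenvelope[OF inj S etriD(1)[OF tQ]] obtain x G y U0 d2 where
    tG: "etriangle C A x G y U0 d2" and G: "G \<in> perp1 C (Filt C \<S>)" and U0: "U0 \<in> Filt C \<S>" .
  from common_inflation_pushout[OF tQ tG] obtain E1 E2 N n1 n2 m1 m2 where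
    N: "conflation C E2 n2 N m1 M" "conflation C E1 n1 N m2 U0" and i: "isomorphic C Q E1" "isomorphic C G E2" .
  have o: "E1 \<in> objs C" "E2 \<in> objs C" using N by (auto simp: conflation_def dest: etriD)
  have "E2 \<in> perp1 C (Filt C \<S>)" by (rule perp1_iso[OF Filt_objs G i(2) o(2)])
  moreover have "E1 \<in> Filt C \<S>" using subcategory_Filt QS o(1) i(1) unfolding subcategory_def by blast
  then have "N \<in> Filt C \<S>"
    using N(2) U0 extension_closed_Filt unfolding conflation_def extension_closed_def by blast
  ultimately show thesis using that N(1) by blast
qed

lemma Filt_closed_under_summands:
  assumes "\<S> \<in> iso_subsets C \<X>" shows "closed_under_summands C (Filt C \<S>)"
  unfolding closed_under_summands_def
proof (intro allI impI)
  fix A A' N i i' p p' assume a: "biproduct C A A' N i i' p p' \<and> N \<in> Filt C \<S>"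
  note B = biproductD[OF conjunct1[OF a]]
  have "A \<in> Filt C \<X>" "A' \<in> Filt C \<X>" using morD(1)[OF B(1)] morD(1)[OF B(2)] generated by auto
  then show "A \<in> Filt C \<S> \<and> A' \<in> Filt C \<S>"
    using Filt_retract[OF assms _ _ B(1,3,5)] Filt_retract[OF assms _ _ B(2,4,6)] a by simp
qed

theorem cotorsion_pair_iff:
  assumes inj: "enough_injectives C" and proj: "enough_projectives C" and S: "\<S> \<in> iso_subsets C \<X>"
  shows "cotorsion_pair C (Filt C \<S>) (perp1 C (Filt C \<S>)) \<longleftrightarrow> projectives C \<subseteq> Filt C \<S>"
proof
  assume c: "cotorsion_pair C (Filt C \<S>) (perp1 C (Filt C \<S>))"
  show "projectives C \<subseteq> Filt C \<S>"
  proof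
    fix P assume "P \<in> projectives C"
    then have P: "is_projective C P" by (simp add: projectives_def)
    then have o: "P \<in> objs C" by (simp add: is_projective_def)
    then obtain V U x y where U: "U \<in> Filt C \<S>" and t: "conflation C V x U y P"
      using c unfolding cotorsion_pair_def by blast
    have "\<exists>g\<in>arr C P U. ident C P = y \<cdot>\<^bsub>C\<^esub> g"
      using P t ident_closed[OF o] unfolding is_projective_def by blast
    moreover have "mor y U P" using t by (auto simp: conflation_def dest: etriD)
    ultimately obtain g where "mor g P U" "mor y U P" "y \<cdot>\<^bsub>C\<^esub> g = ident C P"
      by (auto simp: mor_def)
    then show "P \<in> Filt C \<S>" using Filt_retract[OF S _ U] o generated by blast
  qed
next
  assume P: "projectives C \<subseteq> Filt C \<S>"
  let ?V = "perp1 C (Filt C \<S>)"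
  have V: "?V \<subseteq> objs C" by (auto simp: perp1_def)
  show "cotorsion_pair C (Filt C \<S>) ?V"
    unfolding cotorsion_pair_def
  proof (intro conjI ballI)
    show "subcategory C (Filt C \<S>)" by (rule subcategory_Filt)
    show "subcategory C ?V" unfolding subcategory_def using V perp1_iso[OF Filt_objs] by blast
    show "closed_under_summands C (Filt C \<S>)" by (rule Filt_closed_under_summands[OF S])
    show "closed_under_summands C ?V"
      unfolding closed_under_summands_def
    proof (intro allI impI)
      fix A A' N i i' p p' assume a: "biproduct C A A' N i i' p p' \<and> N \<in> ?V"
      note B = biproductD[OF conjunct1[OF a]]
      show "A \<in> ?V \<and> A' \<in> ?V"
        using perp1_retract[OF Filt_objs conjunct2[OF a] B(1,3,5)] perp1_retract[OF Filt_objs conjunct2[OF a] B(2,4,6)] by simp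
    qed
    show "exts C U N = {zext U N}" if "U \<in> Filt C \<S>" "N \<in> ?V" for U N
      using that by (auto simp: perp1_def)
    show "\<exists>V\<in>?V. \<exists>U\<in>Filt C \<S>. \<exists>x y. conflation C V x U y M" if "M \<in> objs C" for M
      using special_precover[OF inj proj S P that] by metis
    show "\<exists>V'\<in>?V. \<exists>U'\<in>Filt C \<S>. \<exists>x y. conflation C M x V' y U'" if "M \<in> objs C" for M
      using special_preenvelope[OF inj S that] unfolding conflation_def by metis
  qed
qed

text \<open>
  The description of \<open>supp\<close> is meaningful because the intersection of all admissible subsets is again
  admissible, by \<open>Filt_Inter\<close>, and because \<open>Filt\<close> is injective on subsets.
\<close>

lemma supp_props:
  assumes D: "\<D> \<subseteq> objs C"
  shows "supp C \<X> \<D> \<in> iso_subsets C \<X>" "\<D> \<subseteq> Filt C (supp C \<X> \<D>)"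
    "\<And>\<S>. \<lbrakk>\<S> \<in> iso_subsets C \<X>; \<D> \<subseteq> Filt C \<S>\<rbrakk> \<Longrightarrow> supp C \<X> \<D> \<subseteq> \<S>"
proof -
  define \<F> where "\<F> = {\<S> \<in> iso_subsets C \<X>. \<D> \<subseteq> Filt C \<S>}"
  let ?P = "\<lambda>\<S>. \<S> \<in> iso_subsets C \<X> \<and> \<D> \<subseteq> Filt C \<S> \<and>
     (\<forall>\<U>. filtration_subcategory C \<X> \<U> \<and> \<D> \<subseteq> \<U> \<longrightarrow> Filt C \<S> \<subseteq> \<U>)"
  have X: "\<X> \<in> iso_subsets C \<X>" using semibrick by (simp add: iso_subsets_def semibrick_def)
  have F: "\<F> \<subseteq> iso_subsets C \<X>" "\<X> \<in> \<F>" using X D generated unfolding \<F>_def by auto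
  have I: "\<Inter>\<F> \<in> iso_subsets C \<X>" using F unfolding iso_subsets_def subcategory_def by blast
  have "\<F> \<noteq> {}" using F(2) by blast
  then have "\<D> \<subseteq> Filt C (\<Inter>\<F>)" using Filt_Inter[OF F(1)] unfolding \<F>_def by blast
  moreover have "Filt C (\<Inter>\<F>) \<subseteq> \<U>" if U: "filtration_subcategory C \<X> \<U>" "\<D> \<subseteq> \<U>" for \<U>
  proof -
    obtain \<Y> where "\<Y> \<in> iso_subsets C \<X>" "\<U> = Filt C \<Y>" using U(1) unfolding filtration_subcategory_def by blast
    then have "\<Y> \<in> \<F>" "\<U> = Filt C \<Y>" using U(2) unfolding \<F>_def by auto
    then show ?thesis using Filt_mono[of "\<Inter>\<F>" \<Y>] by blast
  qed
  ultimately have PI: "?P (\<Inter>\<F>)" using I by blast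
  have "supp C \<X> \<D> = \<Inter>\<F>"
    unfolding supp_def
  proof (rule the_equality[where P = ?P, OF PI])
    fix \<S> assume "?P \<S>"
    then have S: "\<S> \<in> iso_subsets C \<X>" "\<D> \<subseteq> Filt C \<S>"
      and min: "\<And>\<U>. \<lbrakk>filtration_subcategory C \<X> \<U>; \<D> \<subseteq> \<U>\<rbrakk> \<Longrightarrow> Filt C \<S> \<subseteq> \<U>" by auto
    have "\<Inter>\<F> \<subseteq> \<S>" using S unfolding \<F>_def by blast
    moreover have "Filt C \<S> \<subseteq> Filt C (\<Inter>\<F>)"
    proof (rule min)
      show "filtration_subcategory C \<X> (Filt C (\<Inter>\<F>))" using I unfolding filtration_subcategory_def by blast
    qed (rule conjunct1[OF conjunct2[OF PI]])
    then have "\<S> \<subseteq> \<Inter>\<F>" by (rule iffD1[OF Filt_subset_iff[OF S(1) I]])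
    ultimately show "\<S> = \<Inter>\<F>" by (rule subset_antisym[rotated])
  qed
  then show "supp C \<X> \<D> \<in> iso_subsets C \<X>" "\<D> \<subseteq> Filt C (supp C \<X> \<D>)"
    "\<And>\<S>. \<lbrakk>\<S> \<in> iso_subsets C \<X>; \<D> \<subseteq> Filt C \<S>\<rbrakk> \<Longrightarrow> supp C \<X> \<D> \<subseteq> \<S>"
    using PI unfolding \<F>_def by auto
qed

lemma supp_subset_iff:
  assumes "\<D> \<subseteq> objs C" "\<S> \<in> iso_subsets C \<X>"
  shows "supp C \<X> \<D> \<subseteq> \<S> \<longleftrightarrow> \<D> \<subseteq> Filt C \<S>"
  using supp_props[OF assms(1)] Filt_mono[of "supp C \<X> \<D>" \<S>] assms(2) by blast

lemma supp_Filt: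
  assumes "\<S> \<in> iso_subsets C \<X>" shows "supp C \<X> (Filt C \<S>) = \<S>"
  using supp_subset_iff[OF Filt_objs assms, of \<S>] supp_props(1,2)[OF Filt_objs, of \<S>] Filt_subset_iff[OF assms] by blast

end


section \<open>The correspondence\<close>


text \<open>
  All partial filtrations of an object of \<open>Filt C \<X>\<close> stay in \<open>Filt C \<X>\<close>, so filtering in \<open>C\<close> and filtering in
  the subcategory agree.
\<close>

lemma length_extriangulated_Filt:
  fixes C :: "('o, 'm, 'k, 'e) extri_cat"
  assumes C: "extriangulated_category K C" and X: "semibrick C \<X>"
  shows "length_extriangulated K (restrict_to C (Filt C \<X>)) \<X>"
proof -
  interpret C: semibrick_in_extriangulated K C \<X>
    using C X by (simp add: semibrick_in_extriangulated_def semibrick_in_extriangulated_axioms_def)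
  let ?T = "restrict_to C (Filt C \<X>)"
  obtain Z0 where Z0: "zero_object C Z0" by (rule C.zero_objectE)
  interpret T: extriangulated_category K ?T
    by (rule restrict_extriangulated[OF C C.subcategory_Filt C.extension_closed_Filt Z0 C.zero_in_Filt[OF Z0]])
  have FC: "Filt C \<X> \<subseteq> objs C" using C.subcategory_Filt by (simp add: subcategory_def)
  have XF: "\<X> \<subseteq> Filt C \<X>" using C.generators_in_Filt C.brick_objs by blast
  have "subcategory ?T \<X>"
    unfolding subcategory_def restrict_to_simps isomorphic_restrict
  proof (intro conjI ballI impI XF)
    fix A B assume A: "A \<in> \<X>" "B \<in> Filt C \<X>" "isomorphic C A B"
    have "subcategory C \<X>" using X by (simp only: semibrick_def)
    moreover have "B \<in> objs C" using FC A(2) by (rule subsetD)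
    ultimately show "B \<in> \<X>" using A(1,3) unfolding subcategory_def by (elim conjE) (drule (1) bspec, drule (1) bspec, erule (1) mp)
  qed
  moreover have "brick ?T Y" if "Y \<in> \<X>" for Y
  proof -
    have "End_ring ?T Y = End_ring C Y" by (simp add: End_ring_def)
    then show ?thesis using X XF that unfolding semibrick_def brick_def by auto
  qed
  ultimately have "semibrick ?T \<X>"
    using X unfolding semibrick_def by simp
  moreover have "objs ?T = Filt ?T \<X>"
  proof
    have "C.filtered \<X> n M \<Longrightarrow> M \<in> Filt ?T \<X>" for n M
    proof (induction n arbitrary: M)
      case 0
      then have "zero_object C M" by simp
      then have "zero_object ?T M" using FC C.zero_in_Filt unfolding zero_object_def by auto
      then show ?case by (rule T.zero_in_Filt)
    next
      case (Suc n)
      then obtain M' x y Z d where M: "C.filtered \<X> n M'" "Z \<in> \<X>" "etriangle C M' x M y Z d" by auto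
      have "M \<in> Filt C \<X>" "M' \<in> Filt C \<X>" using Suc.prems M(1) C.Filt_iff by blast+
      then have "etriangle ?T M' x M y Z d" using M(2,3) XF by (auto simp: etriangle_restrict[OF FC])
      then show ?case using T.Filt_extend[OF Suc.IH[OF M(1)] M(2)] by blast
    qed
    then show "objs ?T \<subseteq> Filt ?T \<X>" using C.Filt_iff by auto
    show "Filt ?T \<X> \<subseteq> objs ?T" using T.subcategory_Filt[of \<X>] unfolding subcategory_def by blast
  qed
  ultimately show ?thesis
    by (intro length_extriangulated.intro length_extriangulated_axioms.intro semibrick_in_extriangulated.intro
        semibrick_in_extriangulated_axioms.intro T.extriangulated_category_axioms)
qed

theorem theorem5p6:
  fixes K :: "('k, 'r) ring_scheme"
    and C T :: "('o, 'm, 'k, 'e) extri_cat"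
    and \<X> :: "'o set" and Us Ss :: "'o set set"
  assumes "extriangulated_category K C"
    and "hom_finite K C"
    and "krull_schmidt C"
    and "semibrick C \<X>"
    and "T = restrict_to C (Filt C \<X>)"
    and "enough_projectives T"
    and "enough_injectives T"
    and "Us = {\<U>. filtration_subcategory T \<X> \<U> \<and> cotorsion_pair T \<U> (perp1 T \<U>)}"
    and "Ss = {\<S> \<in> iso_subsets T \<X>. supp T \<X> (projectives T) \<subseteq> \<S>}"
  shows "bij_betw (supp T \<X>) Us Ss \<and> bij_betw (Filt T) Ss Us \<and>
    (\<forall>\<U>\<in>Us. Filt T (supp T \<X> \<U>) = \<U>) \<and> (\<forall>\<S>\<in>Ss. supp T \<X> (Filt T \<S>) = \<S>)"
proof -
  interpret T: length_extriangulated K T \<X>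
    unfolding assms(5) by (rule length_extriangulated_Filt[OF assms(1,4)])
  have P: "projectives T \<subseteq> objs T" by (auto simp: projectives_def is_projective_def)
  have "\<S> \<in> Ss \<longleftrightarrow> \<S> \<in> iso_subsets T \<X> \<and> cotorsion_pair T (Filt T \<S>) (perp1 T (Filt T \<S>))" for \<S>
    unfolding assms(9) using T.cotorsion_pair_iff[OF assms(7,6), of \<S>] T.supp_subset_iff[OF P, of \<S>] by blast
  then have Us_iff: "\<U> \<in> Us \<longleftrightarrow> (\<exists>\<S>\<in>Ss. \<U> = Filt T \<S>)" for \<U>
    unfolding assms(8) filtration_subcategory_def by blast
  have SF: "supp T \<X> (Filt T \<S>) = \<S>" if "\<S> \<in> Ss" for \<S>
    using that T.supp_Filt unfolding assms(9) by blast
  have FS: "Filt T (supp T \<X> \<U>) = \<U>" if "\<U> \<in> Us" for \<U>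
    using that SF unfolding Us_iff by auto
  have 1: "Filt T ` Ss \<subseteq> Us" and 2: "supp T \<X> ` Us \<subseteq> Ss" using Us_iff SF by auto
  have "bij_betw (supp T \<X>) Us Ss" by (rule bij_betw_byWitness[OF _ _ 2 1]) (use FS SF in auto)
  moreover have "bij_betw (Filt T) Ss Us" by (rule bij_betw_byWitness[OF _ _ 1 2]) (use FS SF in auto)
  ultimately show ?thesis using FS SF by blast
qed

end
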